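(* The identity map is the only graded coalgebra automorphism $f$ of $\mathrm{QSym}$ that preserves the set of quasisymmetric Schur functions, i.e. such that $f(\{\mathcal{S}_\alpha:\alpha\in\mathcal{C}\})=\{\mathcal{S}_\alpha:\alpha\in\mathcal{C}\}$.
   Context: A composition is a finite (possibly empty) ordered list $\alpha=(\alpha_1,\dots,\alpha_k)$ of positive integers; $|\alpha|=\alpha_1+\cdots+\alpha_k$, and $\mathcal{C}$ is the set of all compositions ($\emptyset$ is the empty one). $\mathrm{QSym}$ is the set of bounded-degree formal power series $f\in\mathbb{Q}[[x_1,x_2,\dots]]$ such that for each composition $(\alpha_1,\dots,\alpha_k)$ all monomials $x_{i_1}^{\alpha_1}\cdots x_{i_k}^{\alpha_k}$ with $i_1<\cdots<i_k$ have the same coefficient in $f$. Let $M_\emptyset=1$ and $M_\alpha=\sum_{i_1<\cdots<i_k}x_{i_1}^{\alpha_1}\cdots x_{i_k}^{\alpha_k}$. $\mathrm{QSym}=\bigoplus_{n\ge0}\mathrm{QSym}_n$ with $\mathrm{QSym}_n=\mathrm{span}\{M_\alpha:|\alpha|=n\}$ is a graded coalgebra over $\mathbb{Q}$ with coproduct $\Delta(M_\alpha)=\sum_{\alpha=\beta\cdot\gamma}M_\beta\otimes M_\gamma$ (all deconcatenations, empty compositions allowed) and counit $\varepsilon(M_\emptyset)=1$, $\varepsilon(M_\alpha)=0$ for $\alpha\neq\emptyset$. A map is graded if it maps $\mathrm{QSym}_n$ into $\mathrm{QSym}_n$ for all $n$. Quasisymmetric Schur functions: the reverse composition diagram of $\alpha=(\alpha_1,\dots,\alpha_k)$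 is the left-justified array with $\alpha_i$ cells in row $i$ (rows numbered from top to bottom, columns from left to right); $(i,j)$ denotes the cell in row $i$, column $j$. A semistandard reverse composition tableau (SSRCT) of shape $\alpha$ is a filling $\tau$ of the cells of $\alpha$ with positive integers such that (1) entries in each row weakly decrease from left to right; (2) entries in the first column strictly increase from top to bottom; (3) if $i<j$, $(i,k),(j,k+1)\in\alpha$ and $\tau(i,k)\ge\tau(j,k+1)$, then $(i,k+1)\in\alpha$ and $\tau(i,k+1)>\tau(j,k+1)$. Put $x^\tau=\prod_i x_i^{c_i}$ with $c_i$ the number of entries of $\tau$ equal to $i$. Then $\mathcal{S}_\emptyset=1$ and $\mathcal{S}_\alpha=\sum_\tau x^\tau$, sum over all SSRCTs of shape $\alpha$. It is known that $\{\mathcal{S}_\alpha:\alpha\in\mathcal{C}\}$ is a basis of $\mathrm{QSym}$, with $\mathcal{S}_\alpha\in\mathrm{QSym}_{|\alpha|}$. *)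

theory Defs
  imports Complex_Main "HOL-Library.Function_Algebras" "HOL-Library.Poly_Mapping"
begin

section \<open>Formal power series\<close>

text \<open>
  A monomial in \<open>x\<^sub>1, x\<^sub>2, \<dots>\<close> is its finitely supported exponent function, and a formal power
  series is its coefficient function.  Variables are indexed by the positive integers, so the key 0
  never occurs in a monomial that matters; this is enforced in \<open>QSym\<close>.
\<close>

type_synonym monom = "nat \<Rightarrow>\<^sub>0 nat"
type_synonym series = "monom \<Rightarrow> rat"

definition scale :: "rat \<Rightarrow> ('m \<Rightarrow> rat) \<Rightarrow> 'm \<Rightarrow> rat"
  where "scale c f = (\<lambda>m. c * f m)"

interpretation coeffs: vector_space "scale :: rat \<Rightarrow> ('m \<Rightarrow> rat) \<Rightarrow> 'm \<Rightarrow> rat"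
  by unfold_locales (auto simp: scale_def fun_eq_iff algebra_simps)

definition linear_on :: "('m \<Rightarrow> rat) set \<Rightarrow> (('m \<Rightarrow> rat) \<Rightarrow> 'n \<Rightarrow> rat) \<Rightarrow> bool"
  where "linear_on V f \<longleftrightarrow>
    (\<forall>u\<in>V. \<forall>v\<in>V. f (u + v) = f u + f v) \<and> (\<forall>c. \<forall>u\<in>V. f (scale c u) = scale c (f u))"

text \<open>
  The formal sum of the monomials \<open>w a\<close> over \<open>a \<in> A\<close>.  It is only used when every monomial is hit by
  finitely many \<open>a\<close>.
\<close>

definition formal_sum :: "'a set \<Rightarrow> ('a \<Rightarrow> monom) \<Rightarrow> series"
  where "formal_sum A w = (\<lambda>m. of_nat (card {a \<in> A. w a = m}))"

definition monom_degree :: "monom \<Rightarrow> nat"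
  where "monom_degree m = (\<Sum>i\<in>Poly_Mapping.keys m. Poly_Mapping.lookup m i)"


section \<open>Quasisymmetric functions\<close>

definition compositions :: "nat list set"
  where "compositions = {\<alpha>. \<forall>a\<in>set \<alpha>. 0 < a}"

definition index_lists :: "nat \<Rightarrow> nat list set"
  where "index_lists k = {is. length is = k \<and> sorted_wrt (<) is \<and> (\<forall>i\<in>set is. 0 < i)}"

definition power_monom :: "nat list \<Rightarrow> nat list \<Rightarrow> monom"
  where "power_monom is \<alpha> = (\<Sum>(i, a)\<leftarrow>zip is \<alpha>. Poly_Mapping.single i a)"

definition QSym :: "series set"
  where "QSym = {f.
    (\<forall>m. f m \<noteq> 0 \<longrightarrow> 0 \<notin> Poly_Mapping.keys m) \<and>
    (\<exists>d. \<forall>m. f m \<noteq> 0 \<longrightarrow> monom_degree m \<le> d) \<and>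
    (\<forall>\<alpha>\<in>compositions. \<forall>is\<in>index_lists (length \<alpha>). \<forall>js\<in>index_lists (length \<alpha>).
       f (power_monom is \<alpha>) = f (power_monom js \<alpha>))}"

definition M_qsym :: "nat list \<Rightarrow> series"
  where "M_qsym \<alpha> = formal_sum (index_lists (length \<alpha>)) (\<lambda>is. power_monom is \<alpha>)"

definition QSym_hom :: "nat \<Rightarrow> series set"
  where "QSym_hom n = coeffs.span {M_qsym \<alpha> | \<alpha>. \<alpha> \<in> compositions \<and> sum_list \<alpha> = n}"

text \<open>
  The coefficient of \<open>M_qsym \<alpha>\<close> in a quasisymmetric function is that of
  \<open>x\<^sub>1\<^bsup>\<alpha>\<^sub>1\<^esup> \<cdots> x\<^sub>k\<^bsup>\<alpha>\<^sub>k\<^esup>\<close>.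
\<close>

definition M_coeff :: "series \<Rightarrow> nat list \<Rightarrow> rat"
  where "M_coeff f \<alpha> = f (power_monom [1..<Suc (length \<alpha>)] \<alpha>)"


section \<open>The coalgebra structure\<close>

text \<open>
  For spaces \<open>V\<close> and \<open>W\<close> of functions, \<open>V \<otimes> W\<close> is realised in the usual way as the space of functions of
  two arguments spanned by the products \<open>u(m) v(n)\<close>; this realisation is faithful, since the canonical
  map from the abstract tensor product is injective.
\<close>

definition tensor :: "('m \<Rightarrow> rat) \<Rightarrow> ('n \<Rightarrow> rat) \<Rightarrow> 'm \<times> 'n \<Rightarrow> rat"  (infixr "\<otimes>" 75)
  where "u \<otimes> v = (\<lambda>(m, n). u m * v n)"

definition tensor_space :: "('m \<Rightarrow> rat) set \<Rightarrow> ('n \<Rightarrow> rat) set \<Rightarrow> ('m \<times> 'n \<Rightarrow> rat) set"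
  where "tensor_space V W = coeffs.span {u \<otimes> v | u v. u \<in> V \<and> v \<in> W}"

text \<open>
  \<open>F\<close> is the map \<open>f \<otimes> g\<close> on \<open>V \<otimes> W\<close>.  For linear \<open>f\<close> and \<open>g\<close> such an \<open>F\<close> exists and is unique on
  \<open>V \<otimes> W\<close>.
\<close>

definition is_tensor_map ::
    "('m \<Rightarrow> rat) set \<Rightarrow> ('n \<Rightarrow> rat) set \<Rightarrow>
     (('m \<Rightarrow> rat) \<Rightarrow> 'p \<Rightarrow> rat) \<Rightarrow> (('n \<Rightarrow> rat) \<Rightarrow> 'q \<Rightarrow> rat) \<Rightarrow>
     (('m \<times> 'n \<Rightarrow> rat) \<Rightarrow> 'p \<times> 'q \<Rightarrow> rat) \<Rightarrow> bool"
  where "is_tensor_map V W f g F \<longleftrightarrow>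
    linear_on (tensor_space V W) F \<and> (\<forall>u\<in>V. \<forall>v\<in>W. F (u \<otimes> v) = f u \<otimes> g v)"

text \<open>
  The coproduct and the counit are given on the basis \<open>M_qsym\<close> and extended linearly; see the lemmas
  \<open>coproduct_M\<close>, \<open>linear_on_coproduct\<close>, \<open>counit_M\<close> and \<open>counit_linear\<close> below.
\<close>

definition coproduct :: "series \<Rightarrow> monom \<times> monom \<Rightarrow> rat"  ("\<Delta>")
  where "\<Delta> f = (\<Sum>\<alpha> | \<alpha> \<in> compositions \<and> M_coeff f \<alpha> \<noteq> 0.
     scale (M_coeff f \<alpha>)
       (\<Sum>(\<beta>, \<gamma>) | \<beta> @ \<gamma> = \<alpha>. M_qsym \<beta> \<otimes> M_qsym \<gamma>))"

definition counit :: "series \<Rightarrow> rat"  ("\<epsilon>")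
  where "\<epsilon> f = M_coeff f []"

definition coalgebra_hom_QSym :: "(series \<Rightarrow> series) \<Rightarrow> bool"
  where "coalgebra_hom_QSym f \<longleftrightarrow>
    f ` QSym \<subseteq> QSym \<and> linear_on QSym f \<and>
    (\<forall>q\<in>QSym. \<epsilon> (f q) = \<epsilon> q) \<and>
    (\<exists>F. is_tensor_map QSym QSym f f F \<and> (\<forall>q\<in>QSym. \<Delta> (f q) = F (\<Delta> q)))"

definition graded_QSym :: "(series \<Rightarrow> series) \<Rightarrow> bool"
  where "graded_QSym f \<longleftrightarrow> (\<forall>n. f ` QSym_hom n \<subseteq> QSym_hom n)"

text \<open>The inverse of a bijective coalgebra morphism is a coalgebra morphism.\<close>

definition graded_coalgebra_automorphism_QSym :: "(series \<Rightarrow> series) \<Rightarrow> bool"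
  where "graded_coalgebra_automorphism_QSym f \<longleftrightarrow>
    coalgebra_hom_QSym f \<and> graded_QSym f \<and> bij_betw f QSym QSym"


section \<open>Quasisymmetric Schur functions\<close>

definition diagram :: "nat list \<Rightarrow> (nat \<times> nat) set"
  where "diagram \<alpha> = {(i, j). 1 \<le> i \<and> i \<le> length \<alpha> \<and> 1 \<le> j \<and> j \<le> \<alpha> ! (i - 1)}"

text \<open>
  Fillings are functions on all pairs with value 0 outside the diagram, so that each filling is
  represented exactly once.
\<close>

definition SSRCT :: "nat list \<Rightarrow> (nat \<times> nat \<Rightarrow> nat) set"
  where "SSRCT \<alpha> = {\<tau>.
    (\<forall>c\<in>diagram \<alpha>. 0 < \<tau> c) \<and> (\<forall>c. c \<notin> diagram \<alpha> \<longrightarrow> \<tau> c = 0) \<and>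
    (\<forall>i j j'. (i, j) \<in> diagram \<alpha> \<and> (i, j') \<in> diagram \<alpha> \<and> j \<le> j' \<longrightarrow> \<tau> (i, j') \<le> \<tau> (i, j)) \<and>
    (\<forall>i i'. (i, 1) \<in> diagram \<alpha> \<and> (i', 1) \<in> diagram \<alpha> \<and> i < i' \<longrightarrow> \<tau> (i, 1) < \<tau> (i', 1)) \<and>
    (\<forall>i j k. i < j \<and> (i, k) \<in> diagram \<alpha> \<and> (j, k + 1) \<in> diagram \<alpha> \<and> \<tau> (j, k + 1) \<le> \<tau> (i, k)
       \<longrightarrow> (i, k + 1) \<in> diagram \<alpha> \<and> \<tau> (j, k + 1) < \<tau> (i, k + 1))}"

definition tableau_weight :: "nat list \<Rightarrow> (nat \<times> nat \<Rightarrow> nat) \<Rightarrow> monom"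
  where "tableau_weight \<alpha> \<tau> = (\<Sum>c\<in>diagram \<alpha>. Poly_Mapping.single (\<tau> c) 1)"

definition qschur :: "nat list \<Rightarrow> series"
  where "qschur \<alpha> = formal_sum (SSRCT \<alpha>) (tableau_weight \<alpha>)"


section \<open>The coproduct and counit on the monomial basis\<close>

lemma power_monom_Nil [simp]: "power_monom [] [] = 0"
  by (simp add: power_monom_def)

lemma power_monom_Cons [simp]:
  "power_monom (i # is) (a # \<alpha>) = Poly_Mapping.single i a + power_monom is \<alpha>"
  by (simp add: power_monom_def)

lemma lookup_power_monom_notin:
  "length is = length \<alpha> \<Longrightarrow> i \<notin> set is \<Longrightarrow> Poly_Mapping.lookup (power_monom is \<alpha>) i = 0"
  by (induction "is" \<alpha> rule: list_induct2) (auto simp: lookup_add lookup_single)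

lemma lookup_power_monom:
  "length is = length \<alpha> \<Longrightarrow> distinct is \<Longrightarrow> map (Poly_Mapping.lookup (power_monom is \<alpha>)) is = \<alpha>"
proof (induction "is" \<alpha> rule: list_induct2)
  case (Cons i "is" a \<alpha>)
  have "map (Poly_Mapping.lookup (power_monom (i # is) (a # \<alpha>))) is
      = map (Poly_Mapping.lookup (power_monom is \<alpha>)) is"
    using Cons.prems by (auto simp: lookup_add lookup_single when_def)
  also have "\<dots> = \<alpha>"
    using Cons by simp
  finally show ?case
    using Cons by (simp only: list.map) (simp add: lookup_add lookup_power_monom_notin)
qed simp

lemma index_listsD:
  assumes "is \<in> index_lists k"
  shows "length is = k" "distinct is" "sorted is" "0 \<notin> set is"
  using assms by (auto simp: index_lists_def strict_sorted_iff)

lemma keys_power_monom: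
  assumes "is \<in> index_lists (length \<alpha>)" "\<alpha> \<in> compositions"
  shows "Poly_Mapping.keys (power_monom is \<alpha>) = set is"
proof -
  note is_facts = index_listsD[OF assms(1)]
  have "Poly_Mapping.lookup (power_monom is \<alpha>) ` set is = set \<alpha>"
    using arg_cong[OF lookup_power_monom[OF is_facts(1,2)], of set] by simp
  then have "Poly_Mapping.lookup (power_monom is \<alpha>) i \<in> set \<alpha>" if "i \<in> set is" for i
    using that by blast
  then have "Poly_Mapping.lookup (power_monom is \<alpha>) i \<noteq> 0" if "i \<in> set is" for i
    using that assms(2) by (fastforce simp: compositions_def)
  then show ?thesis
    using lookup_power_monom_notin[OF is_facts(1)] by (force simp: in_keys_iff)
qed

lemma power_monom_inj:
  assumes "is \<in> index_lists (length \<alpha>)" "\<alpha> \<in> compositions"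
    and "js \<in> index_lists (length \<beta>)" "\<beta> \<in> compositions"
    and eq: "power_monom is \<alpha> = power_monom js \<beta>"
  shows "is = js" "\<alpha> = \<beta>"
proof -
  show "is = js"
    using keys_power_monom[OF assms(1,2)] keys_power_monom[OF assms(3,4)] eq
      index_listsD[OF assms(1)] index_listsD[OF assms(3)] sorted_distinct_set_unique by metis
  then show "\<alpha> = \<beta>"
    using lookup_power_monom index_listsD[OF assms(1)] index_listsD[OF assms(3)] eq by metis
qed

lemma degree_power_monom:
  assumes "is \<in> index_lists (length \<alpha>)" "\<alpha> \<in> compositions"
  shows "monom_degree (power_monom is \<alpha>) = sum_list \<alpha>"
proof -
  note is_facts = index_listsD[OF assms(1)]
  have "monom_degree (power_monom is \<alpha>) = sum_list (map (Poly_Mapping.lookup (power_monom is \<alpha>)) is)"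
    unfolding monom_degree_def keys_power_monom[OF assms]
    using is_facts(2) by (simp add: sum_list_distinct_conv_sum_set)
  then show ?thesis
    using lookup_power_monom[OF is_facts(1,2)] by simp
qed

lemma upt_index_lists: "[1..<Suc k] \<in> index_lists k"
  by (auto simp: index_lists_def simp del: upt_Suc)

lemma M_apply:
  assumes "\<alpha> \<in> compositions"
  shows "M_qsym \<alpha> m = (if m \<in> (\<lambda>is. power_monom is \<alpha>) ` index_lists (length \<alpha>) then 1 else 0)"
proof (cases "m \<in> (\<lambda>is. power_monom is \<alpha>) ` index_lists (length \<alpha>)")
  case True
  then obtain "is" where "is": "is \<in> index_lists (length \<alpha>)" "m = power_monom is \<alpha>" by auto
  have "{js \<in> index_lists (length \<alpha>). power_monom js \<alpha> = m} = {is}"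
    using "is" power_monom_inj(1)[OF _ assms _ assms] by blast
  then show ?thesis
    using True by (simp add: M_qsym_def formal_sum_def)
next
  case False
  then have "{js \<in> index_lists (length \<alpha>). power_monom js \<alpha> = m} = {}" by auto
  then show ?thesis
    using False by (simp only: M_qsym_def formal_sum_def card.empty if_False of_nat_0)
qed

lemma M_qsym_in_QSym:
  assumes "\<alpha> \<in> compositions"
  shows "M_qsym \<alpha> \<in> QSym"
  unfolding QSym_def
proof (intro CollectI conjI ballI allI impI)
  fix m assume "M_qsym \<alpha> m \<noteq> 0"
  then obtain "is" where "is": "is \<in> index_lists (length \<alpha>)" "m = power_monom is \<alpha>"
    by (auto simp: M_apply[OF assms] split: if_splits)
  then show "0 \<notin> Poly_Mapping.keys m"
    using keys_power_monom[OF "is"(1) assms] index_listsD(4) by metis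
next
  show "\<exists>d. \<forall>m. M_qsym \<alpha> m \<noteq> 0 \<longrightarrow> monom_degree m \<le> d"
    using degree_power_monom[OF _ assms]
    by (intro exI[of _ "sum_list \<alpha>"]) (auto simp: M_apply[OF assms] split: if_splits)
next
  fix \<beta> "is" js
  assume \<beta>: "\<beta> \<in> compositions" "is \<in> index_lists (length \<beta>)" "js \<in> index_lists (length \<beta>)"
  have "M_qsym \<alpha> (power_monom ks \<beta>) = (if \<alpha> = \<beta> then 1 else 0)" if "ks \<in> index_lists (length \<beta>)" for ks
    using power_monom_inj(2)[OF that \<beta>(1) _ assms] that by (auto simp: M_apply[OF assms])
  with \<beta> show "M_qsym \<alpha> (power_monom is \<beta>) = M_qsym \<alpha> (power_monom js \<beta>)" by simp
qed

lemma M_coeff_M: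
  assumes "\<alpha> \<in> compositions" "\<beta> \<in> compositions"
  shows "M_coeff (M_qsym \<alpha>) \<beta> = (if \<alpha> = \<beta> then 1 else 0)"
  using power_monom_inj(2)[OF upt_index_lists assms(2) _ assms(1)] upt_index_lists
  unfolding M_coeff_def M_apply[OF assms(1)] by fastforce

lemma M_coeff_add: "M_coeff (f + g) \<alpha> = M_coeff f \<alpha> + M_coeff g \<alpha>"
  by (simp add: M_coeff_def)

lemma M_coeff_scale: "M_coeff (scale c f) \<alpha> = c * M_coeff f \<alpha>"
  by (simp add: M_coeff_def scale_def)

lemma finite_M_coeff:
  assumes "f \<in> QSym"
  shows "finite {\<alpha> \<in> compositions. M_coeff f \<alpha> \<noteq> 0}"
proof -
  obtain d where d: "\<And>m. f m \<noteq> 0 \<Longrightarrow> monom_degree m \<le> d"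
    using assms by (auto simp: QSym_def)
  have "set \<alpha> \<subseteq> {..d} \<and> length \<alpha> \<le> d" if "\<alpha> \<in> compositions" "M_coeff f \<alpha> \<noteq> 0" for \<alpha>
  proof -
    have le: "sum_list \<alpha> \<le> d"
      using d that(2) degree_power_monom[OF upt_index_lists that(1)] unfolding M_coeff_def by metis
    have "length \<alpha> \<le> sum_list \<alpha>"
      using that(1) by (induction \<alpha>) (auto simp: compositions_def Suc_le_eq add_strict_increasing)
    with le show ?thesis
      using member_le_sum_list by (auto intro: order_trans)
  qed
  then show ?thesis
    by (intro finite_subset[OF _ finite_lists_length_le[of "{..d}" d]]) auto
qed

lemma coproduct_M:
  assumes "\<alpha> \<in> compositions"
  shows "\<Delta> (M_qsym \<alpha>) = (\<Sum>(\<beta>, \<gamma>) | \<beta> @ \<gamma> = \<alpha>. M_qsym \<beta> \<otimes> M_qsym \<gamma>)"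
proof -
  have "{\<beta>. \<beta> \<in> compositions \<and> M_coeff (M_qsym \<alpha>) \<beta> \<noteq> 0} = {\<alpha>}"
    using assms by (auto simp: M_coeff_M split: if_splits)
  then show ?thesis
    using assms by (simp add: coproduct_def M_coeff_M scale_def)
qed

lemma coproduct_superset:
  assumes "finite A" "A \<subseteq> compositions" "{\<alpha> \<in> compositions. M_coeff f \<alpha> \<noteq> 0} \<subseteq> A"
  shows "\<Delta> f = (\<Sum>\<alpha>\<in>A. scale (M_coeff f \<alpha>) (\<Sum>(\<beta>, \<gamma>) | \<beta> @ \<gamma> = \<alpha>. M_qsym \<beta> \<otimes> M_qsym \<gamma>))"
  unfolding coproduct_def
  using assms by (intro sum.mono_neutral_left) (auto simp: coeffs.scale_zero_left)

lemma linear_on_coproduct: "linear_on QSym \<Delta>"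
  unfolding linear_on_def
proof (intro conjI ballI allI)
  fix u v assume "u \<in> QSym" "v \<in> QSym"
  define A where "A = {\<alpha> \<in> compositions. M_coeff u \<alpha> \<noteq> 0} \<union> {\<alpha> \<in> compositions. M_coeff v \<alpha> \<noteq> 0}"
  have A: "finite A" "A \<subseteq> compositions"
    using finite_M_coeff \<open>u \<in> QSym\<close> \<open>v \<in> QSym\<close> by (auto simp: A_def)
  have "{\<alpha> \<in> compositions. M_coeff w \<alpha> \<noteq> 0} \<subseteq> A" if "w \<in> {u, v, u + v}" for w
    using that by (auto simp: A_def M_coeff_add)
  from this[THEN coproduct_superset[OF A]]
  show "\<Delta> (u + v) = \<Delta> u + \<Delta> v"
    by (simp add: M_coeff_add coeffs.scale_left_distrib sum.distrib)
next
  fix c u assume "u \<in> QSym"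
  show "\<Delta> (scale c u) = scale c (\<Delta> u)"
  proof (cases "c = 0")
    case True
    then show ?thesis by (simp add: coproduct_def M_coeff_def)
  next
    case False
    then show ?thesis
      by (simp add: coproduct_def M_coeff_scale coeffs.scale_sum_right)
  qed
qed

lemma counit_M: "\<alpha> \<in> compositions \<Longrightarrow> \<epsilon> (M_qsym \<alpha>) = (if \<alpha> = [] then 1 else 0)"
  by (simp add: counit_def M_coeff_M compositions_def)

lemma counit_linear: "\<epsilon> (f + g) = \<epsilon> f + \<epsilon> g" "\<epsilon> (scale c f) = c * \<epsilon> f"
  by (simp_all add: counit_def M_coeff_add M_coeff_scale)

end

theory Submission
  imports Defs "HOL-Library.Multiset"
begin

text \<open>
  Let \<open>K \<alpha> \<gamma>\<close> be the number of SSRCTs of shape \<open>\<alpha>\<close> and content \<open>\<gamma>\<close>, so that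
  \<open>S\<^sub>\<alpha> = \<Sum>\<^sub>\<gamma> K \<alpha> \<gamma> M\<^sub>\<gamma>\<close>.  Everything rests on a few elementary facts about these numbers.  The first
  column of a tableau is strictly increasing, so \<open>K \<alpha> \<gamma> \<noteq> 0\<close> forces \<open>length \<alpha> \<le> length \<gamma>\<close>
  (\<open>kostka_length_le\<close>).  If the lengths agree, the first column is \<open>1, 2, \<dots>\<close>; the triple condition
  then forces the second entry of row \<open>i\<close> to be \<open>i\<close> as well, so that \<open>\<gamma>\<^sub>i = 1\<close> implies \<open>\<alpha>\<^sub>i = 1\<close>
  (\<open>kostka_parts_1\<close>), and moreover \<open>\<alpha>\<close> is at most \<open>\<gamma>\<close> lexicographically.  Hence \<open>K\<close> is triangular
  (\<open>kostka_lenlex\<close>) with nonzero diagonal (\<open>kostka_refl\<close>), and a linear map that fixes every \<open>S\<^sub>\<alpha>\<close> of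
  degree \<open>n\<close> fixes \<open>QSym\<^sub>n\<close>.

  Let \<open>f\<close> be an automorphism as in the theorem.  By induction on \<open>n\<close>, it fixes all \<open>S\<^sub>\<alpha>\<close> of degree \<open>n\<close>.
  Suppose that \<open>f\<close> is the identity in smaller degrees.  Comparing coproducts, \<open>f(S\<^sub>\<alpha>)\<close> and \<open>S\<^sub>\<alpha>\<close> differ by
  a primitive element, a multiple of \<open>M\<^sub>n\<close>; and \<open>M\<^sub>n\<close> occurs only in \<open>S\<^sub>n\<close>.  As \<open>f(S\<^sub>\<alpha>) = S\<^sub>\<beta>\<close> for some
  \<open>\<beta>\<close>, it follows that \<open>S\<^sub>\<beta> = S\<^sub>\<alpha>\<close>, unless exactly one of \<open>\<alpha>\<close>, \<open>\<beta>\<close> is \<open>(n)\<close> and the other, say \<open>\<delta>\<close>, satisfies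
  \<open>S\<^sub>\<delta> = S\<^sub>n - M\<^sub>n\<close>.  In the latter case the contents \<open>(1, n-1)\<close> and \<open>(n-1, 1)\<close> both occur in shape \<open>\<delta>\<close>,
  and for \<open>n \<ge> 3\<close> this contradicts \<open>kostka_parts_1\<close> (\<open>fixes_qschur_step\<close>).

  Degree 2 is the exception: there exchanging \<open>S\<^sub>2 = M\<^sub>2 + M\<^sub>1\<^sub>1\<close> and \<open>S\<^sub>1\<^sub>1 = M\<^sub>1\<^sub>1\<close> is
  compatible with the coproduct, and the obstruction only appears in degree 4
  (\<open>fixes_qschur_degree_2\<close>).  Such an exchange determines the coefficients of the image of
  \<open>S\<^sub>2\<^sub>1\<^sub>1 = M\<^sub>2\<^sub>1\<^sub>1 + M\<^sub>1\<^sub>1\<^sub>1\<^sub>1\<close> at all compositions of 4 with parts at most 2: they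
  are 0 at \<open>22\<close> and \<open>211\<close>, and 1 at \<open>121\<close> and \<open>112\<close>.  No \<open>S\<^sub>\<beta>\<close> has these coefficients: the contents
  \<open>121\<close> and \<open>112\<close> exclude shapes of length at least 3, and every shape of length at most 2 admits
  the content \<open>22\<close> or \<open>211\<close>.

  For the converse, the identity preserves the \<open>S\<^sub>\<alpha>\<close> because they do lie in \<open>QSym\<close>
  (\<open>qschur_in_QSym\<close>): the conditions on a tableau only involve the relative order of its entries.
\<close>

section \<open>Quasisymmetric functions through their monomial coefficients\<close>

text \<open>
  The monomial at which \<open>M_coeff\<close> reads off the coefficient of \<open>M_qsym \<gamma>\<close>.
\<close>

abbreviation std_monom :: "nat list \<Rightarrow> monom"
  where "std_monom \<gamma> \<equiv> power_monom [1..<Suc (length \<gamma>)] \<gamma>"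

definition comps :: "nat \<Rightarrow> nat list set"
  where "comps n = {\<alpha> \<in> compositions. sum_list \<alpha> = n}"

lemma compsD: "\<alpha> \<in> comps n \<Longrightarrow> \<alpha> \<in> compositions" "\<alpha> \<in> comps n \<Longrightarrow> sum_list \<alpha> = n"
  by (simp_all add: comps_def)

lemma composition_simps [simp]:
  "[] \<in> compositions"
  "a # \<alpha> \<in> compositions \<longleftrightarrow> 0 < a \<and> \<alpha> \<in> compositions"
  "\<alpha> @ \<beta> \<in> compositions \<longleftrightarrow> \<alpha> \<in> compositions \<and> \<beta> \<in> compositions"
  by (auto simp: compositions_def)

lemma length_le_sum_list_composition: "\<alpha> \<in> compositions \<Longrightarrow> length \<alpha> \<le> sum_list \<alpha>"
  by (induction \<alpha>) auto

lemma sum_list_composition_eq_0: "\<alpha> \<in> compositions \<Longrightarrow> sum_list \<alpha> = 0 \<longleftrightarrow> \<alpha> = []"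
  by (cases \<alpha>) auto

lemma finite_comps: "finite (comps n)"
proof (rule finite_subset)
  show "comps n \<subseteq> {\<alpha>. set \<alpha> \<subseteq> {..n} \<and> length \<alpha> \<le> n}"
    using member_le_sum_list length_le_sum_list_composition by (fastforce simp: comps_def)
qed (simp add: finite_lists_length_le)

lemma comps_2: "comps 2 = {[2], [1, 1]}"
proof (intro subset_antisym subsetI)
  fix \<alpha> :: "nat list" assume "\<alpha> \<in> comps 2"
  then show "\<alpha> \<in> {[2], [1, 1]}"
    by (cases \<alpha>; cases "tl \<alpha>"; cases "tl (tl \<alpha>)") (auto simp: comps_def)
qed (auto simp: comps_def)

lemma monom_eq_power_monom:
  assumes "0 \<notin> Poly_Mapping.keys m"
  obtains "is" \<alpha> where "\<alpha> \<in> compositions" "is \<in> index_lists (length \<alpha>)" "m = power_monom is \<alpha>"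
proof
  define js where "js = sorted_list_of_set (Poly_Mapping.keys m)"
  define \<alpha> where "\<alpha> = map (Poly_Mapping.lookup m) js"
  have js: "set js = Poly_Mapping.keys m" "sorted_wrt (<) js"
    by (simp_all add: js_def)
  show "\<alpha> \<in> compositions"
    using js by (auto simp: \<alpha>_def compositions_def in_keys_iff)
  show ind: "js \<in> index_lists (length \<alpha>)"
    using js assms by (simp add: \<alpha>_def index_lists_def) (metis gr0I)
  show "m = power_monom js \<alpha>"
  proof (rule poly_mapping_eqI)
    fix i
    have "map (Poly_Mapping.lookup (power_monom js \<alpha>)) js = map (Poly_Mapping.lookup m) js"
      using lookup_power_monom[OF index_listsD(1,2)[OF ind]] unfolding \<alpha>_def .
    then have "\<forall>i\<in>set js. Poly_Mapping.lookup (power_monom js \<alpha>) i = Poly_Mapping.lookup m i"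
      by (simp only: map_eq_conv)
    then show "Poly_Mapping.lookup m i = Poly_Mapping.lookup (power_monom js \<alpha>) i"
      using lookup_power_monom_notin[OF index_listsD(1)[OF ind]] js(1)
      by (cases "i \<in> set js") (simp_all add: in_keys_iff)
  qed
qed

lemma QSym_eqI:
  assumes "p \<in> QSym" "q \<in> QSym"
    and eq: "\<And>\<gamma>. \<gamma> \<in> compositions \<Longrightarrow> M_coeff p \<gamma> = M_coeff q \<gamma>"
  shows "p = q"
proof
  fix m show "p m = q m"
  proof (cases "0 \<in> Poly_Mapping.keys m")
    case True
    then have "p m = 0" "q m = 0"
      using assms(1,2) unfolding QSym_def by blast+
    then show ?thesis by simp
  next
    case False
    then obtain "is" \<alpha> where *: "\<alpha> \<in> compositions" "is \<in> index_lists (length \<alpha>)" "m = power_monom is \<alpha>"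
      by (rule monom_eq_power_monom)
    have "r m = M_coeff r \<alpha>" if "r \<in> QSym" for r
      using that * upt_index_lists unfolding QSym_def M_coeff_def by blast
    then show ?thesis using assms(1,2) eq[OF *(1)] by simp
  qed
qed

lemma subspace_QSym: "coeffs.subspace QSym"
  unfolding coeffs.subspace_def
proof (intro conjI ballI allI)
  show "0 \<in> QSym" by (simp add: QSym_def)
next
  fix p q assume pq: "p \<in> QSym" "q \<in> QSym"
  then obtain d e where d: "\<And>m. p m \<noteq> 0 \<Longrightarrow> monom_degree m \<le> d"
      and e: "\<And>m. q m \<noteq> 0 \<Longrightarrow> monom_degree m \<le> e"
    unfolding QSym_def by blast
  have nonzero: "p m \<noteq> 0 \<or> q m \<noteq> 0" if "(p + q) m \<noteq> 0" for m
    using that by auto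
  have "monom_degree m \<le> max d e" if "(p + q) m \<noteq> 0" for m
    using nonzero[OF that] d[of m] e[of m] by (meson max.coboundedI1 max.coboundedI2)
  moreover have "0 \<notin> Poly_Mapping.keys m" if "(p + q) m \<noteq> 0" for m
    using pq nonzero[OF that] unfolding QSym_def by blast
  moreover have "(p + q) (power_monom is \<alpha>) = (p + q) (power_monom js \<alpha>)"
    if "\<alpha> \<in> compositions" "is \<in> index_lists (length \<alpha>)" "js \<in> index_lists (length \<alpha>)" for \<alpha> "is" js
  proof -
    have "r (power_monom is \<alpha>) = r (power_monom js \<alpha>)" if "r \<in> QSym" for r
      using that \<open>\<alpha> \<in> compositions\<close> \<open>is \<in> _\<close> \<open>js \<in> _\<close> unfolding QSym_def by blast
    from this[OF pq(1)] this[OF pq(2)] show ?thesis by simp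
  qed
  ultimately show "p + q \<in> QSym"
    unfolding QSym_def by blast
next
  fix c p assume "p \<in> QSym"
  then obtain d where d: "\<And>m. p m \<noteq> 0 \<Longrightarrow> monom_degree m \<le> d"
    unfolding QSym_def by blast
  have nonzero: "p m \<noteq> 0" if "scale c p m \<noteq> 0" for m
    using that by (auto simp: scale_def)
  have "0 \<notin> Poly_Mapping.keys m" if "scale c p m \<noteq> 0" for m
    using \<open>p \<in> QSym\<close> nonzero[OF that] unfolding QSym_def by blast
  moreover have "scale c p (power_monom is \<alpha>) = scale c p (power_monom js \<alpha>)"
    if "\<alpha> \<in> compositions" "is \<in> index_lists (length \<alpha>)" "js \<in> index_lists (length \<alpha>)" for \<alpha> "is" js
  proof -
    have "p (power_monom is \<alpha>) = p (power_monom js \<alpha>)"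
      using that \<open>p \<in> QSym\<close> unfolding QSym_def by blast
    then show ?thesis by (simp add: scale_def)
  qed
  ultimately show "scale c p \<in> QSym"
    using d nonzero unfolding QSym_def by blast
qed

lemma M_coeff_sum: "M_coeff (\<Sum>a\<in>A. g a) \<gamma> = (\<Sum>a\<in>A. M_coeff (g a) \<gamma>)"
  by (induction A rule: infinite_finite_induct) (auto simp: M_coeff_add, auto simp: M_coeff_def)

lemma M_expansion:
  assumes "q \<in> QSym" "finite A" "A \<subseteq> compositions"
    and supp: "\<And>\<gamma>. \<gamma> \<in> compositions \<Longrightarrow> M_coeff q \<gamma> \<noteq> 0 \<Longrightarrow> \<gamma> \<in> A"
  shows "q = (\<Sum>\<alpha>\<in>A. scale (M_coeff q \<alpha>) (M_qsym \<alpha>))"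
proof (rule QSym_eqI)
  show "(\<Sum>\<alpha>\<in>A. scale (M_coeff q \<alpha>) (M_qsym \<alpha>)) \<in> QSym"
    using assms(3) subspace_QSym M_qsym_in_QSym
    by (intro coeffs.subspace_sum coeffs.subspace_scale) auto
next
  fix \<gamma> assume \<gamma>: "\<gamma> \<in> compositions"
  have "M_coeff (\<Sum>\<alpha>\<in>A. scale (M_coeff q \<alpha>) (M_qsym \<alpha>)) \<gamma>
      = (\<Sum>\<alpha>\<in>A. if \<alpha> = \<gamma> then M_coeff q \<gamma> else 0)"
    unfolding M_coeff_sum M_coeff_scale
    using \<gamma> assms(3) by (intro sum.cong) (auto simp: M_coeff_M)
  also have "\<dots> = M_coeff q \<gamma>"
    using supp[OF \<gamma>] assms(2) by auto
  finally show "M_coeff q \<gamma> = M_coeff (\<Sum>\<alpha>\<in>A. scale (M_coeff q \<alpha>) (M_qsym \<alpha>)) \<gamma>" by (rule sym)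
qed (rule assms(1))

lemma QSym_hom_coeff:
  assumes "q \<in> QSym_hom n" "\<gamma> \<in> compositions" "sum_list \<gamma> \<noteq> n"
  shows "M_coeff q \<gamma> = 0"
  using assms(1) unfolding QSym_hom_def
proof (induction rule: coeffs.span_induct)
  case base
  then show ?case by (auto simp: coeffs.subspace_def M_coeff_add M_coeff_scale, simp add: M_coeff_def)
next
  case (step q)
  then show ?case using assms(2,3) by (auto simp: M_coeff_M)
qed

lemma M_in_QSym_hom: "\<alpha> \<in> comps n \<Longrightarrow> M_qsym \<alpha> \<in> QSym_hom n"
  unfolding QSym_hom_def comps_def by (intro coeffs.span_base) auto

lemma QSym_hom_subset: "QSym_hom n \<subseteq> QSym"
  unfolding QSym_hom_def
  by (intro coeffs.span_minimal subspace_QSym) (auto simp: M_qsym_in_QSym)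

lemma linear_on_sum:
  assumes "coeffs.subspace V" "linear_on V f" "finite A" "\<And>a. a \<in> A \<Longrightarrow> v a \<in> V"
  shows "f (\<Sum>a\<in>A. scale (c a) (v a)) = (\<Sum>a\<in>A. scale (c a) (f (v a)))"
  using assms(3,4)
proof (induction A)
  case empty
  have "f (scale 0 0) = scale 0 (f 0)"
    using assms(1,2) unfolding linear_on_def coeffs.subspace_def by blast
  then show ?case by (simp only: sum.empty coeffs.scale_zero_left)
next
  case (insert a A)
  have "scale (c a) (v a) \<in> V" "(\<Sum>a\<in>A. scale (c a) (v a)) \<in> V"
    using assms(1) insert by (auto intro!: coeffs.subspace_sum coeffs.subspace_scale)
  then have "f (\<Sum>a\<in>insert a A. scale (c a) (v a))
      = f (scale (c a) (v a)) + f (\<Sum>a\<in>A. scale (c a) (v a))"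
    using assms(2) insert by (simp add: linear_on_def del: plus_fun_def)
  also have "f (scale (c a) (v a)) = scale (c a) (f (v a))"
    using assms(2) insert(4) by (simp add: linear_on_def)
  finally show ?case
    using insert by (simp only: sum.insert insert_iff simp_thms)
qed

lemma sum_fun_apply: "(\<Sum>a\<in>A. g a) x = (\<Sum>a\<in>A. g a x)"
  for g :: "'a \<Rightarrow> 'b \<Rightarrow> rat"
  by (induction A rule: infinite_finite_induct) auto

lemma splits_eq: "{(\<beta>, \<gamma>). \<beta> @ \<gamma> = \<alpha>} = (\<lambda>i. (take i \<alpha>, drop i \<alpha>)) ` {..length \<alpha>}"
proof (intro subset_antisym subsetI)
  fix p assume "p \<in> {(\<beta>, \<gamma>). \<beta> @ \<gamma> = \<alpha>}"
  then have "p = (take (length (fst p)) \<alpha>, drop (length (fst p)) \<alpha>)" "length (fst p) \<le> length \<alpha>"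
    by auto
  then show "p \<in> (\<lambda>i. (take i \<alpha>, drop i \<alpha>)) ` {..length \<alpha>}" by blast
qed auto

lemma finite_splits: "finite {(\<beta>, \<gamma>). \<beta> @ \<gamma> = \<alpha>}"
  by (simp add: splits_eq)

lemma sum_splits:
  "(\<Sum>(\<beta>, \<gamma>) | \<beta> @ \<gamma> = \<alpha>. g \<beta> \<gamma>) = (\<Sum>i\<le>length \<alpha>. g (take i \<alpha>) (drop i \<alpha>))"
proof -
  have "inj_on (\<lambda>i. (take i \<alpha>, drop i \<alpha>)) {..length \<alpha>}"
    by (rule inj_on_inverseI[of _ "\<lambda>p. length (fst p)"]) auto
  then show ?thesis
    by (simp add: splits_eq sum.reindex)
qed

text \<open>
  Evaluating a series in two sets of variables at a pair of such monomials extracts the coefficient of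
  \<open>M_qsym \<beta> \<otimes> M_qsym \<gamma>\<close>, and deconcatenation produces this term only from \<open>M_qsym (\<beta> @ \<gamma>)\<close>.
\<close>

lemma coproduct_coeff:
  assumes "q \<in> QSym" "\<beta> \<in> compositions" "\<gamma> \<in> compositions"
  shows "\<Delta> q (std_monom \<beta>, std_monom \<gamma>) = M_coeff q (\<beta> @ \<gamma>)"
proof -
  define A where "A = {\<alpha> \<in> compositions. M_coeff q \<alpha> \<noteq> 0}"
  have A: "finite A" using finite_M_coeff[OF assms(1)] by (simp add: A_def)
  have inner: "(\<Sum>(\<beta>', \<gamma>') | \<beta>' @ \<gamma>' = \<alpha>. M_qsym \<beta>' \<otimes> M_qsym \<gamma>') (std_monom \<beta>, std_monom \<gamma>)
      = (if \<alpha> = \<beta> @ \<gamma> then 1 else 0)" if "\<alpha> \<in> compositions" for \<alpha>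
  proof -
    have "(\<Sum>(\<beta>', \<gamma>') | \<beta>' @ \<gamma>' = \<alpha>. M_qsym \<beta>' \<otimes> M_qsym \<gamma>') (std_monom \<beta>, std_monom \<gamma>)
      = (\<Sum>p | fst p @ snd p = \<alpha>. M_coeff (M_qsym (fst p)) \<beta> * M_coeff (M_qsym (snd p)) \<gamma>)"
      unfolding sum_fun_apply by (simp add: tensor_def M_coeff_def case_prod_unfold)
    also have "\<dots> = (\<Sum>p | fst p @ snd p = \<alpha>. if p = (\<beta>, \<gamma>) then 1 else 0)"
    proof (intro sum.cong refl)
      fix p assume "p \<in> {p. fst p @ snd p = \<alpha>}"
      then have "fst p \<in> compositions" "snd p \<in> compositions"
        using that by auto
      then show "M_coeff (M_qsym (fst p)) \<beta> * M_coeff (M_qsym (snd p)) \<gamma> = (if p = (\<beta>, \<gamma>) then 1 else 0)"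
        using assms by (simp add: M_coeff_M prod_eq_iff)
    qed
    also have "\<dots> = (if \<alpha> = \<beta> @ \<gamma> then 1 else 0)"
      using finite_splits[of \<alpha>] by (simp add: case_prod_unfold eq_commute)
    finally show ?thesis .
  qed
  have "\<Delta> q (std_monom \<beta>, std_monom \<gamma>)
      = (\<Sum>\<alpha>\<in>A. M_coeff q \<alpha> * (if \<alpha> = \<beta> @ \<gamma> then 1 else 0))"
    unfolding coproduct_def A_def[symmetric] sum_fun_apply[of _ A]
  proof (intro sum.cong refl)
    fix \<alpha> assume "\<alpha> \<in> A"
    then have "\<alpha> \<in> compositions" by (simp add: A_def)
    from inner[OF this] show "scale (M_coeff q \<alpha>) (\<Sum>(\<beta>', \<gamma>') | \<beta>' @ \<gamma>' = \<alpha>. M_qsym \<beta>' \<otimes> M_qsym \<gamma>')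
        (std_monom \<beta>, std_monom \<gamma>) = M_coeff q \<alpha> * (if \<alpha> = \<beta> @ \<gamma> then 1 else 0)"
      by (simp only: scale_def)
  qed
  also have "\<dots> = (\<Sum>\<alpha>\<in>A. if \<alpha> = \<beta> @ \<gamma> then M_coeff q (\<beta> @ \<gamma>) else 0)"
    by (intro sum.cong) auto
  also have "\<dots> = M_coeff q (\<beta> @ \<gamma>)"
    using A assms(2,3) by (auto simp: A_def)
  finally show ?thesis .
qed

section \<open>Matrix coefficients of graded coalgebra endomorphisms\<close>

locale graded_coalgebra_endo =
  fixes f :: "series \<Rightarrow> series"
  assumes hom: "coalgebra_hom_QSym f" and graded: "graded_QSym f"
begin

lemma linear: "linear_on QSym f" and maps_QSym: "q \<in> QSym \<Longrightarrow> f q \<in> QSym"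
  using hom by (auto simp: coalgebra_hom_QSym_def)

lemma coeff_other_degree:
  assumes "\<alpha> \<in> compositions" "\<gamma> \<in> compositions" "sum_list \<alpha> \<noteq> sum_list \<gamma>"
  shows "M_coeff (f (M_qsym \<alpha>)) \<gamma> = 0"
proof -
  have "f (M_qsym \<alpha>) \<in> QSym_hom (sum_list \<alpha>)"
    using graded assms(1) M_in_QSym_hom by (auto simp: graded_QSym_def comps_def)
  then show ?thesis using QSym_hom_coeff assms by auto
qed

text \<open>
  The morphism property in coordinates.  Iterated, it expresses the whole matrix of \<open>f\<close> in the basis
  \<open>M_qsym\<close> through the coefficients at one-part compositions.
\<close>

lemma coeff_append:
  assumes "\<alpha> \<in> compositions" "\<beta> \<in> compositions" "\<gamma> \<in> compositions"
  shows "M_coeff (f (M_qsym \<alpha>)) (\<beta> @ \<gamma>)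
    = (\<Sum>i\<le>length \<alpha>. M_coeff (f (M_qsym (take i \<alpha>))) \<beta> * M_coeff (f (M_qsym (drop i \<alpha>))) \<gamma>)"
proof -
  obtain F where F: "is_tensor_map QSym QSym f f F" "\<And>q. q \<in> QSym \<Longrightarrow> \<Delta> (f q) = F (\<Delta> q)"
    using hom by (auto simp: coalgebra_hom_QSym_def)
  let ?P = "\<lambda>i. M_qsym (take i \<alpha>)" and ?S = "\<lambda>i. M_qsym (drop i \<alpha>)"
  have QS: "?P i \<in> QSym" "?S i \<in> QSym" for i
    using assms(1) M_qsym_in_QSym by (metis append_take_drop_id composition_simps(3))+
  have "\<Delta> (f (M_qsym \<alpha>)) = F (\<Sum>i\<le>length \<alpha>. scale 1 (?P i \<otimes> ?S i))"
    using F(2) M_qsym_in_QSym assms(1) coproduct_M by (simp add: sum_splits)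
  also have "\<dots> = (\<Sum>i\<le>length \<alpha>. scale 1 (F (?P i \<otimes> ?S i)))"
  proof (rule linear_on_sum)
    show "linear_on (tensor_space QSym QSym) F"
      using F(1) by (simp add: is_tensor_map_def)
    show "coeffs.subspace (tensor_space QSym QSym)"
      by (simp add: tensor_space_def)
    show "?P i \<otimes> ?S i \<in> tensor_space QSym QSym" for i
      unfolding tensor_space_def using QS by (intro coeffs.span_base) blast
  qed simp
  also have "\<dots> = (\<Sum>i\<le>length \<alpha>. f (?P i) \<otimes> f (?S i))"
    using F(1) QS by (simp add: is_tensor_map_def)
  finally have "\<Delta> (f (M_qsym \<alpha>)) (std_monom \<beta>, std_monom \<gamma>)
      = (\<Sum>i\<le>length \<alpha>. f (?P i) \<otimes> f (?S i)) (std_monom \<beta>, std_monom \<gamma>)"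
    by simp
  also have "\<dots> = (\<Sum>i\<le>length \<alpha>. (f (?P i) \<otimes> f (?S i)) (std_monom \<beta>, std_monom \<gamma>))"
    by (rule sum_fun_apply)
  finally show ?thesis
    using coproduct_coeff[OF maps_QSym[OF M_qsym_in_QSym[OF assms(1)]] assms(2,3)]
    by (simp add: tensor_def M_coeff_def)
qed

end

section \<open>Tableaux and their contents\<close>

lemma mem_diagram: "(i, j) \<in> diagram \<alpha> \<longleftrightarrow> 1 \<le> i \<and> i \<le> length \<alpha> \<and> 1 \<le> j \<and> j \<le> \<alpha> ! (i - 1)"
  by (simp add: diagram_def)

lemma diagram_Sigma: "diagram \<alpha> = Sigma {1..length \<alpha>} (\<lambda>i. {1..\<alpha> ! (i - 1)})"
  by (auto simp: diagram_def)

lemma finite_diagram [simp]: "finite (diagram \<alpha>)"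
  by (simp add: diagram_Sigma)

lemma card_diagram: "card (diagram \<alpha>) = sum_list \<alpha>"
  by (simp add: diagram_Sigma sum_list_sum_nth sum.atLeast1_atMost_eq atLeast0LessThan)

lemma first_column_mem: "\<alpha> \<in> compositions \<Longrightarrow> 1 \<le> i \<Longrightarrow> i \<le> length \<alpha> \<Longrightarrow> (i, 1) \<in> diagram \<alpha>"
  by (auto simp: mem_diagram compositions_def Suc_le_eq)

lemma SSRCT_row: "\<tau> \<in> SSRCT \<alpha> \<Longrightarrow> (i, j) \<in> diagram \<alpha> \<Longrightarrow> (i, j') \<in> diagram \<alpha> \<Longrightarrow> j \<le> j' \<Longrightarrow> \<tau> (i, j') \<le> \<tau> (i, j)"
  and SSRCT_column: "\<tau> \<in> SSRCT \<alpha> \<Longrightarrow> (i, 1) \<in> diagram \<alpha> \<Longrightarrow> (i', 1) \<in> diagram \<alpha> \<Longrightarrow> i < i' \<Longrightarrow> \<tau> (i, 1) < \<tau> (i', 1)"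
  and SSRCT_triple: "\<tau> \<in> SSRCT \<alpha> \<Longrightarrow> i < j \<Longrightarrow> (i, k) \<in> diagram \<alpha> \<Longrightarrow> (j, k + 1) \<in> diagram \<alpha> \<Longrightarrow> \<tau> (j, k + 1) \<le> \<tau> (i, k)
    \<Longrightarrow> (i, k + 1) \<in> diagram \<alpha> \<and> \<tau> (j, k + 1) < \<tau> (i, k + 1)"
  and SSRCT_pos: "\<tau> \<in> SSRCT \<alpha> \<Longrightarrow> c \<in> diagram \<alpha> \<Longrightarrow> 0 < \<tau> c"
  and SSRCT_outside: "\<tau> \<in> SSRCT \<alpha> \<Longrightarrow> c \<notin> diagram \<alpha> \<Longrightarrow> \<tau> c = 0"
  unfolding SSRCT_def by blast+

lemma lookup_tableau_weight:
  "Poly_Mapping.lookup (tableau_weight \<alpha> \<tau>) s = card {c \<in> diagram \<alpha>. \<tau> c = s}"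
  unfolding tableau_weight_def
  by (simp add: lookup_sum lookup_single when_def sum.If_cases Int_def)

lemma keys_tableau_weight: "Poly_Mapping.keys (tableau_weight \<alpha> \<tau>) = \<tau> ` diagram \<alpha>"
proof (rule set_eqI)
  fix s
  have "s \<in> Poly_Mapping.keys (tableau_weight \<alpha> \<tau>) \<longleftrightarrow> {c \<in> diagram \<alpha>. \<tau> c = s} \<noteq> {}"
    unfolding in_keys_iff lookup_tableau_weight by (subst card_0_eq) auto
  then show "s \<in> Poly_Mapping.keys (tableau_weight \<alpha> \<tau>) \<longleftrightarrow> s \<in> \<tau> ` diagram \<alpha>" by blast
qed

lemma degree_tableau_weight: "monom_degree (tableau_weight \<alpha> \<tau>) = sum_list \<alpha>"
  using sum.group[of "diagram \<alpha>" "\<tau> ` diagram \<alpha>" \<tau> "\<lambda>_. 1 :: nat"]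
  by (simp add: monom_degree_def keys_tableau_weight lookup_tableau_weight card_diagram)

lemma finite_tableaux_of_weight: "finite {\<tau> \<in> SSRCT \<alpha>. tableau_weight \<alpha> \<tau> = m}"
proof (rule finite_subset)
  show "{\<tau> \<in> SSRCT \<alpha>. tableau_weight \<alpha> \<tau> = m}
      \<subseteq> {\<tau>. \<forall>c. (c \<in> diagram \<alpha> \<longrightarrow> \<tau> c \<in> Poly_Mapping.keys m) \<and> (c \<notin> diagram \<alpha> \<longrightarrow> \<tau> c = 0)}"
    using keys_tableau_weight SSRCT_outside by blast
qed (intro finite_set_of_finite_funs finite_diagram finite_keys)

text \<open>
  Only the relative order of the entries matters in the definition of an SSRCT.
\<close>

lemma relabel_SSRCT:
  assumes "\<tau> \<in> SSRCT \<alpha>"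
    and mono: "\<And>x y. x \<in> \<tau> ` diagram \<alpha> \<Longrightarrow> y \<in> \<tau> ` diagram \<alpha> \<Longrightarrow> r x < r y \<longleftrightarrow> x < (y :: nat)"
    and "r 0 = 0" and pos: "\<And>x. x \<in> \<tau> ` diagram \<alpha> \<Longrightarrow> 0 < (r x :: nat)"
  shows "r \<circ> \<tau> \<in> SSRCT \<alpha>"
proof -
  have less: "r (\<tau> c) < r (\<tau> d) \<longleftrightarrow> \<tau> c < \<tau> d" and le: "r (\<tau> c) \<le> r (\<tau> d) \<longleftrightarrow> \<tau> c \<le> \<tau> d"
    if "c \<in> diagram \<alpha>" "d \<in> diagram \<alpha>" for c d
    using mono[of "\<tau> c" "\<tau> d"] mono[of "\<tau> d" "\<tau> c"] that by (auto simp: not_less[symmetric])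
  show ?thesis
    unfolding SSRCT_def mem_Collect_eq o_apply
  proof (intro conjI allI impI ballI)
    show "0 < r (\<tau> c)" if "c \<in> diagram \<alpha>" for c
      using pos that by blast
    show "r (\<tau> c) = 0" if "c \<notin> diagram \<alpha>" for c
      using SSRCT_outside[OF assms(1) that] assms(3) by simp
    show "r (\<tau> (i, j')) \<le> r (\<tau> (i, j))"
      if "(i, j) \<in> diagram \<alpha> \<and> (i, j') \<in> diagram \<alpha> \<and> j \<le> j'" for i j j'
      using SSRCT_row[OF assms(1)] that le by blast
    show "r (\<tau> (i, 1)) < r (\<tau> (i', 1))"
      if "(i, 1) \<in> diagram \<alpha> \<and> (i', 1) \<in> diagram \<alpha> \<and> i < i'" for i i'
      using SSRCT_column[OF assms(1)] that less by blast
    fix i j k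
    assume *: "i < j \<and> (i, k) \<in> diagram \<alpha> \<and> (j, k + 1) \<in> diagram \<alpha> \<and> r (\<tau> (j, k + 1)) \<le> r (\<tau> (i, k))"
    then have "\<tau> (j, k + 1) \<le> \<tau> (i, k)" using le by blast
    then show "(i, k + 1) \<in> diagram \<alpha>" and "r (\<tau> (j, k + 1)) < r (\<tau> (i, k + 1))"
      using SSRCT_triple[OF assms(1)] * less by blast+
  qed
qed

text \<open>
  Replacing the letters \<open>is\<close> by the letters \<open>js\<close> in order is injective on tableaux; exchanging the two
  lists gives the opposite inequality.
\<close>

lemma card_tableaux_relabel_le:
  assumes "\<beta> \<in> compositions" "is \<in> index_lists (length \<beta>)" "js \<in> index_lists (length \<beta>)"
  shows "card {\<tau> \<in> SSRCT \<alpha>. tableau_weight \<alpha> \<tau> = power_monom is \<beta>}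
       \<le> card {\<tau> \<in> SSRCT \<alpha>. tableau_weight \<alpha> \<tau> = power_monom js \<beta>}"
proof -
  note isD = index_listsD[OF assms(2)] and jsD = index_listsD[OF assms(3)]
  define r where "r = (\<lambda>x. if x \<in> set is then the (map_of (zip is js) x) else 0)"
  have r_nth: "r (is ! k) = js ! k" if "k < length is" for k
    using that isD jsD by (simp add: r_def map_of_zip_nth)
  have r_0: "r 0 = 0" using isD by (simp add: r_def)
  have strict: "sorted_wrt (<) is" "sorted_wrt (<) js"
    using assms by (auto simp: index_lists_def)
  have nth_less: "xs ! k < xs ! l \<longleftrightarrow> k < l"
    if "sorted_wrt (<) xs" "k < length xs" "l < length xs" for xs :: "nat list" and k l
    using that by (metis linorder_less_linear order_less_asym sorted_wrt_nth_less)
  have r_less: "r x < r y \<longleftrightarrow> x < y" if "x \<in> set is" "y \<in> set is" for x y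
    using that r_nth nth_less[OF strict(1)] nth_less[OF strict(2)] isD jsD by (auto simp: in_set_conv_nth)
  have r_inj: "inj_on r (set is)"
    using r_less by (metis inj_onI linorder_neqE_nat order_less_irrefl)
  have r_in: "r x \<in> set js" if "x \<in> set is" for x
    using that r_nth isD jsD by (auto simp: in_set_conv_nth)
  have entries: "\<tau> ` diagram \<alpha> = set is" if "tableau_weight \<alpha> \<tau> = power_monom is \<beta>" for \<tau>
    using keys_tableau_weight[of \<alpha> \<tau>] keys_power_monom[OF assms(2,1)] that by simp
  show ?thesis
  proof (rule card_inj_on_le[of "\<lambda>\<tau>. r \<circ> \<tau>"])
    show "inj_on (\<lambda>\<tau>. r \<circ> \<tau>) {\<tau> \<in> SSRCT \<alpha>. tableau_weight \<alpha> \<tau> = power_monom is \<beta>}"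
    proof (rule inj_onI, clarify)
      fix \<tau> \<sigma>
      assume *: "\<tau> \<in> SSRCT \<alpha>" "tableau_weight \<alpha> \<tau> = power_monom is \<beta>"
        "\<sigma> \<in> SSRCT \<alpha>" "tableau_weight \<alpha> \<sigma> = power_monom is \<beta>" "r \<circ> \<tau> = r \<circ> \<sigma>"
      show "\<tau> = \<sigma>"
      proof
        fix c
        show "\<tau> c = \<sigma> c"
        proof (cases "c \<in> diagram \<alpha>")
          case True
          then have "\<tau> c \<in> set is" "\<sigma> c \<in> set is"
            using entries[OF *(2)] entries[OF *(4)] by blast+
          moreover have "r (\<tau> c) = r (\<sigma> c)"
            using *(5) by (metis o_apply)
          ultimately show ?thesis using r_inj by (simp add: inj_on_eq_iff)
        next
          case False
          show ?thesis
            using SSRCT_outside[OF *(1) False] SSRCT_outside[OF *(3) False] by simp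
        qed
      qed
    qed
    show "(\<lambda>\<tau>. r \<circ> \<tau>) ` {\<tau> \<in> SSRCT \<alpha>. tableau_weight \<alpha> \<tau> = power_monom is \<beta>}
        \<subseteq> {\<tau> \<in> SSRCT \<alpha>. tableau_weight \<alpha> \<tau> = power_monom js \<beta>}"
    proof clarify
      fix \<tau> assume \<tau>: "\<tau> \<in> SSRCT \<alpha>" "tableau_weight \<alpha> \<tau> = power_monom is \<beta>"
      note ent = entries[OF \<tau>(2)]
      have "r \<circ> \<tau> \<in> SSRCT \<alpha>"
      proof (rule relabel_SSRCT[OF \<tau>(1)])
        show "r x < r y \<longleftrightarrow> x < y" if "x \<in> \<tau> ` diagram \<alpha>" "y \<in> \<tau> ` diagram \<alpha>" for x y
          using that r_less ent by blast
        show "0 < r x" if "x \<in> \<tau> ` diagram \<alpha>" for x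
          using that r_in jsD(4) ent by (metis gr0I)
      qed (rule r_0)
      moreover have "tableau_weight \<alpha> (r \<circ> \<tau>) = power_monom js \<beta>"
      proof (rule poly_mapping_eqI)
        fix s
        show "Poly_Mapping.lookup (tableau_weight \<alpha> (r \<circ> \<tau>)) s = Poly_Mapping.lookup (power_monom js \<beta>) s"
        proof (cases "s \<in> set js")
          case True
          then obtain k where k: "k < length js" "s = js ! k"
            by (auto simp: in_set_conv_nth)
          have "r (\<tau> c) = s \<longleftrightarrow> \<tau> c = is ! k" if "c \<in> diagram \<alpha>" for c
          proof -
            have "\<tau> c \<in> set is" "is ! k \<in> set is" "s = r (is ! k)"
              using that ent k isD(1) jsD(1) r_nth by auto
            then show ?thesis using r_inj by (simp add: inj_on_eq_iff)
          qed
          then have "{c \<in> diagram \<alpha>. (r \<circ> \<tau>) c = s} = {c \<in> diagram \<alpha>. \<tau> c = is ! k}"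
            by auto
          then have "Poly_Mapping.lookup (tableau_weight \<alpha> (r \<circ> \<tau>)) s
              = Poly_Mapping.lookup (tableau_weight \<alpha> \<tau>) (is ! k)"
            by (simp only: lookup_tableau_weight)
          also have "\<dots> = Poly_Mapping.lookup (power_monom is \<beta>) (is ! k)"
            by (simp only: \<tau>(2))
          also have "\<dots> = \<beta> ! k"
            using lookup_power_monom[OF isD(1,2)] k isD(1) jsD(1) by (metis nth_map)
          also have "\<dots> = Poly_Mapping.lookup (power_monom js \<beta>) s"
            using lookup_power_monom[OF jsD(1,2)] k by (metis nth_map)
          finally show ?thesis .
        next
          case False
          then have "{c \<in> diagram \<alpha>. (r \<circ> \<tau>) c = s} = {}"
            using r_in ent by auto
          then have "Poly_Mapping.lookup (tableau_weight \<alpha> (r \<circ> \<tau>)) s = 0"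
            by (metis card.empty lookup_tableau_weight)
          then show ?thesis
            using lookup_power_monom_notin[OF jsD(1) False] by simp
        qed
      qed
      ultimately show "r \<circ> \<tau> \<in> SSRCT \<alpha> \<and> tableau_weight \<alpha> (r \<circ> \<tau>) = power_monom js \<beta>" ..
    qed
  qed (rule finite_tableaux_of_weight)
qed

lemma qschur_in_QSym: "qschur \<alpha> \<in> QSym"
proof -
  have wt: "\<exists>\<tau>\<in>SSRCT \<alpha>. tableau_weight \<alpha> \<tau> = m" if "qschur \<alpha> m \<noteq> 0" for m
  proof (rule ccontr)
    assume "\<not> ?thesis"
    then have "{\<tau> \<in> SSRCT \<alpha>. tableau_weight \<alpha> \<tau> = m} = {}" by blast
    then have "qschur \<alpha> m = 0" by (simp only: qschur_def formal_sum_def card.empty of_nat_0)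
    with that show False by simp
  qed
  have "0 \<notin> Poly_Mapping.keys m" if "qschur \<alpha> m \<noteq> 0" for m
    using wt[OF that] SSRCT_pos keys_tableau_weight by (metis imageE less_irrefl)
  moreover have "monom_degree m \<le> sum_list \<alpha>" if "qschur \<alpha> m \<noteq> 0" for m
    using wt[OF that] degree_tableau_weight by auto
  moreover have "qschur \<alpha> (power_monom is \<beta>) = qschur \<alpha> (power_monom js \<beta>)"
    if "\<beta> \<in> compositions" "is \<in> index_lists (length \<beta>)" "js \<in> index_lists (length \<beta>)" for \<beta> "is" js
    unfolding qschur_def formal_sum_def of_nat_eq_iff
    using that by (intro order_antisym card_tableaux_relabel_le)
  ultimately show ?thesis
    unfolding QSym_def by blast
qed

section \<open>Kostka numbers of reverse composition tableaux\<close>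

definition tableaux :: "nat list \<Rightarrow> nat list \<Rightarrow> (nat \<times> nat \<Rightarrow> nat) set"
  where "tableaux \<alpha> \<gamma> = {\<tau> \<in> SSRCT \<alpha>. tableau_weight \<alpha> \<tau> = std_monom \<gamma>}"

text \<open>
  The analogue of a Kostka number: the coefficient of \<open>M_qsym \<gamma>\<close> in \<open>qschur \<alpha>\<close>.
\<close>

definition kostka :: "nat list \<Rightarrow> nat list \<Rightarrow> nat"
  where "kostka \<alpha> \<gamma> = card (tableaux \<alpha> \<gamma>)"

lemma M_coeff_qschur: "M_coeff (qschur \<alpha>) \<gamma> = of_nat (kostka \<alpha> \<gamma>)"
  unfolding M_coeff_def qschur_def formal_sum_def kostka_def tableaux_def ..

lemma kostka_neq_0_iff: "kostka \<alpha> \<gamma> \<noteq> 0 \<longleftrightarrow> tableaux \<alpha> \<gamma> \<noteq> {}"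
  unfolding kostka_def tableaux_def by (subst card_0_eq[OF finite_tableaux_of_weight]) (rule refl)

lemma sum_list_eq_if_kostka:
  assumes "kostka \<alpha> \<gamma> \<noteq> 0" "\<gamma> \<in> compositions"
  shows "sum_list \<gamma> = sum_list \<alpha>"
proof -
  obtain \<tau> where "tableau_weight \<alpha> \<tau> = std_monom \<gamma>"
    using assms(1) unfolding kostka_neq_0_iff tableaux_def by blast
  then show ?thesis
    using degree_tableau_weight[of \<alpha> \<tau>] degree_power_monom[OF upt_index_lists assms(2)] by argo
qed

lemma tableaux_entry:
  assumes "\<tau> \<in> tableaux \<alpha> \<gamma>" "c \<in> diagram \<alpha>"
  shows "1 \<le> \<tau> c" "\<tau> c \<le> length \<gamma>"
proof -
  have "tableau_weight \<alpha> \<tau> = std_monom \<gamma>"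
    using assms(1) by (simp only: tableaux_def mem_Collect_eq)
  then have "Poly_Mapping.keys (std_monom \<gamma>) = \<tau> ` diagram \<alpha>"
    using keys_tableau_weight[of \<alpha> \<tau>] by (simp only:)
  then have "\<tau> c \<in> Poly_Mapping.keys (std_monom \<gamma>)"
    using assms(2) by blast
  then have "Poly_Mapping.lookup (std_monom \<gamma>) (\<tau> c) \<noteq> 0"
    by (simp only: in_keys_iff not_False_eq_True)
  then have "\<tau> c \<in> set [1..<Suc (length \<gamma>)]"
    using lookup_power_monom_notin[of "[1..<Suc (length \<gamma>)]" \<gamma> "\<tau> c"] by (auto simp del: upt_Suc)
  then show "1 \<le> \<tau> c" "\<tau> c \<le> length \<gamma>" by auto
qed

lemma tableaux_count:
  assumes "\<tau> \<in> tableaux \<alpha> \<gamma>" "k < length \<gamma>"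
  shows "card {c \<in> diagram \<alpha>. \<tau> c = Suc k} = \<gamma> ! k"
proof -
  have "map (Poly_Mapping.lookup (std_monom \<gamma>)) [1..<Suc (length \<gamma>)] = \<gamma>"
    by (rule lookup_power_monom) (simp_all del: upt_Suc)
  then have "Poly_Mapping.lookup (std_monom \<gamma>) ([1..<Suc (length \<gamma>)] ! k) = \<gamma> ! k"
    using assms(2) by (metis length_map nth_map)
  then have "Poly_Mapping.lookup (std_monom \<gamma>) (Suc k) = \<gamma> ! k"
    using assms(2) by (simp del: upt_Suc)
  moreover have "tableau_weight \<alpha> \<tau> = std_monom \<gamma>"
    using assms(1) by (simp only: tableaux_def mem_Collect_eq)
  ultimately show ?thesis
    using lookup_tableau_weight[of \<alpha> \<tau> "Suc k"] by argo
qed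

lemma first_column_ge:
  assumes "\<tau> \<in> SSRCT \<alpha>" "\<alpha> \<in> compositions" "1 \<le> i" "i \<le> length \<alpha>"
  shows "i \<le> \<tau> (i, 1)"
  using assms(3,4)
proof (induction i rule: dec_induct)
  case base
  then show ?case using SSRCT_pos[OF assms(1) first_column_mem[OF assms(2)]] by (simp add: Suc_le_eq)
next
  case (step i)
  then show ?case
    using SSRCT_column[OF assms(1), of i "Suc i"] first_column_mem[OF assms(2)] by fastforce
qed

lemma kostka_length_le:
  assumes "kostka \<alpha> \<gamma> \<noteq> 0" "\<alpha> \<in> compositions"
  shows "length \<alpha> \<le> length \<gamma>"
proof (cases "\<alpha> = []")
  case False
  obtain \<tau> where \<tau>: "\<tau> \<in> tableaux \<alpha> \<gamma>"
    using assms(1) unfolding kostka_neq_0_iff by blast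
  have l: "1 \<le> length \<alpha>" using False by (simp add: Suc_le_eq)
  have "length \<alpha> \<le> \<tau> (length \<alpha>, 1)"
    using first_column_ge[OF _ assms(2) l] \<tau> by (simp add: tableaux_def)
  also have "\<dots> \<le> length \<gamma>"
    using tableaux_entry[OF \<tau>] first_column_mem[OF assms(2) l] by blast
  finally show ?thesis .
qed simp

lemma first_column_eq:
  assumes "\<tau> \<in> tableaux \<alpha> \<gamma>" "\<alpha> \<in> compositions" "length \<alpha> = length \<gamma>" "1 \<le> i" "i \<le> length \<alpha>"
  shows "\<tau> (i, 1) = i"
proof -
  have S: "\<tau> \<in> SSRCT \<alpha>" using assms(1) by (simp add: tableaux_def)
  have "\<tau> (i, 1) \<le> i"
    using assms(5,4)
  proof (induction i rule: inc_induct)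
    case base
    then show ?case using tableaux_entry[OF assms(1) first_column_mem[OF assms(2)]] assms(3) by auto
  next
    case (step i)
    then show ?case
      using SSRCT_column[OF S, of i "Suc i"] first_column_mem[OF assms(2)] by fastforce
  qed
  then show ?thesis using first_column_ge[OF S assms(2,4,5)] by simp
qed

text \<open>
  A smaller entry \<open>s\<close> in this cell would equal the first entry of row \<open>s\<close>, which lies further up.  The
  triple condition would then make row \<open>s\<close> increase from its first to its second cell.
\<close>

lemma second_column_eq:
  assumes "\<tau> \<in> tableaux \<alpha> \<gamma>" "\<alpha> \<in> compositions" "length \<alpha> = length \<gamma>" "(i, 2) \<in> diagram \<alpha>"
  shows "\<tau> (i, 2) = i"
proof (rule ccontr)
  assume neq: "\<tau> (i, 2) \<noteq> i"
  have S: "\<tau> \<in> SSRCT \<alpha>" using assms(1) by (simp add: tableaux_def)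
  have i: "1 \<le> i" "i \<le> length \<alpha>" using assms(4) by (auto simp: mem_diagram)
  define s where "s = \<tau> (i, 2)"
  have "s \<le> \<tau> (i, 1)"
    using SSRCT_row[OF S first_column_mem[OF assms(2) i] assms(4)] by (simp add: s_def)
  then have s: "1 \<le> s" "s < i" "s \<le> length \<alpha>"
    using first_column_eq[OF assms(1-3) i] neq i tableaux_entry[OF assms(1,4)] by (auto simp: s_def)
  have first: "\<tau> (s, 1) = s" by (rule first_column_eq[OF assms(1-3) s(1,3)])
  have "(s, 2) \<in> diagram \<alpha>" "s < \<tau> (s, 2)"
    using SSRCT_triple[OF S s(2) first_column_mem[OF assms(2) s(1,3)], unfolded one_add_one] assms(4) first
    by (auto simp: s_def)
  then show False
    using SSRCT_row[OF S first_column_mem[OF assms(2) s(1,3)], of 2] first by simp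
qed

text \<open>
  A row \<open>i\<close> with at least two cells contains the letter \<open>i\<close> at least twice, in its first two cells.
\<close>

lemma kostka_parts_1:
  assumes "kostka \<alpha> \<gamma> \<noteq> 0" "\<alpha> \<in> compositions" "length \<alpha> = length \<gamma>"
    and "i < length \<alpha>" "\<gamma> ! i = 1"
  shows "\<alpha> ! i = 1"
proof (rule ccontr)
  assume "\<alpha> ! i \<noteq> 1"
  moreover have "0 < \<alpha> ! i" using assms(2,4) by (simp add: compositions_def)
  ultimately have mem: "(Suc i, 1) \<in> diagram \<alpha>" "(Suc i, 2) \<in> diagram \<alpha>"
    using assms(4) by (auto simp: mem_diagram)
  obtain \<tau> where \<tau>: "\<tau> \<in> tableaux \<alpha> \<gamma>"
    using assms(1) unfolding kostka_neq_0_iff by blast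
  have "{(Suc i, 1), (Suc i, 2)} \<subseteq> {c \<in> diagram \<alpha>. \<tau> c = Suc i}"
    using mem first_column_eq[OF \<tau> assms(2,3), of "Suc i"] second_column_eq[OF \<tau> assms(2,3) mem(2)] assms(4)
    by auto
  then have "card {(Suc i, 1 :: nat), (Suc i, 2)} \<le> card {c \<in> diagram \<alpha>. \<tau> c = Suc i}"
    by (intro card_mono) auto
  also have "\<dots> = \<gamma> ! i"
    using tableaux_count[OF \<tau>, of i] assms(3,4) by simp
  also have "\<dots> = 1" by (rule assms(5))
  finally show False by simp
qed

text \<open>
  The rows before \<open>p\<close> use up all copies of their own letters, and row \<open>p\<close> starts with its own
  letter (counting rows and letters from 0), so that it must consist of this letter alone.
\<close>

lemma tableaux_first_difference:
  assumes "\<tau> \<in> tableaux \<alpha> \<gamma>" "\<alpha> \<in> compositions" "length \<alpha> = length \<gamma>"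
    and "p < length \<alpha>" and same: "\<And>r. r < p \<Longrightarrow> \<alpha> ! r = \<gamma> ! r"
  shows "\<alpha> ! p \<le> \<gamma> ! p"
proof -
  have S: "\<tau> \<in> SSRCT \<alpha>" using assms(1) by (simp add: tableaux_def)
  define row where "row s = {s} \<times> {1..\<alpha> ! (s - 1)}" for s
  have const: "row s \<subseteq> {c \<in> diagram \<alpha>. \<tau> c = s}" if "1 \<le> s" "s \<le> Suc p" for s
    using that
  proof (induction s rule: less_induct)
    case (less s)
    have mem: "row s \<subseteq> diagram \<alpha>"
      using less.prems assms(4) by (auto simp: row_def mem_diagram)
    have "\<tau> (s, j) = s" if j: "(s, j) \<in> row s" for j
    proof (rule ccontr)
      assume neq: "\<tau> (s, j) \<noteq> s"
      define t where "t = \<tau> (s, j)"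
      have sj: "(s, j) \<in> diagram \<alpha>" using mem j by blast
      have "t \<le> \<tau> (s, 1)"
        using SSRCT_row[OF S first_column_mem[OF assms(2)] sj] less.prems assms(4) sj
        by (auto simp: t_def mem_diagram)
      then have t: "1 \<le> t" "t < s"
        using first_column_eq[OF assms(1-3) less.prems(1)] less.prems assms(4) neq tableaux_entry[OF assms(1) sj]
        by (auto simp: t_def)
      have "card (row t) = card {c \<in> diagram \<alpha>. \<tau> c = t}"
        using tableaux_count[OF assms(1), of "t - 1"] same[of "t - 1"] t less.prems assms(3,4)
        by (simp add: row_def)
      with less.IH[OF t(2,1)] t less.prems have "row t = {c \<in> diagram \<alpha>. \<tau> c = t}"
        by (intro card_subset_eq) auto
      then have "(s, j) \<in> row t" using sj by (simp add: t_def)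
      then show False using t by (simp add: row_def)
    qed
    then show ?case using mem by (auto simp: row_def)
  qed
  have "\<alpha> ! p = card (row (Suc p))" by (simp add: row_def)
  also have "\<dots> \<le> card {c \<in> diagram \<alpha>. \<tau> c = Suc p}"
    by (intro card_mono const) auto
  also have "\<dots> = \<gamma> ! p"
    using tableaux_count[OF assms(1)] assms(3,4) by simp
  finally show ?thesis .
qed

lemma kostka_lenlex:
  assumes "kostka \<alpha> \<gamma> \<noteq> 0" "\<alpha> \<in> compositions" "\<alpha> \<noteq> \<gamma>"
  shows "(\<alpha>, \<gamma>) \<in> lenlex less_than"
proof (cases "length \<alpha> = length \<gamma>")
  case True
  obtain \<tau> where \<tau>: "\<tau> \<in> tableaux \<alpha> \<gamma>"
    using assms(1) unfolding kostka_neq_0_iff by blast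
  define p where "p = (LEAST p. p < length \<alpha> \<and> \<alpha> ! p \<noteq> \<gamma> ! p)"
  have "\<exists>p. p < length \<alpha> \<and> \<alpha> ! p \<noteq> \<gamma> ! p"
    using True assms(3) by (auto simp: list_eq_iff_nth_eq)
  then have p: "p < length \<alpha>" "\<alpha> ! p \<noteq> \<gamma> ! p"
    unfolding p_def using LeastI_ex[of "\<lambda>p. p < length \<alpha> \<and> \<alpha> ! p \<noteq> \<gamma> ! p"] by blast+
  have same: "\<alpha> ! r = \<gamma> ! r" if "r < p" for r
    using not_less_Least[of r "\<lambda>p. p < length \<alpha> \<and> \<alpha> ! p \<noteq> \<gamma> ! p"] that p(1) by (simp add: p_def)
  have "\<alpha> ! p < \<gamma> ! p"
    using tableaux_first_difference[OF \<tau> assms(2) True p(1) same] p(2) by simp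
  moreover have "take p \<alpha> = take p \<gamma>"
    using same p(1) True by (intro nth_take_lemma) auto
  ultimately have "(\<alpha>, \<gamma>) \<in> lex less_than"
    using p(1) True by (auto simp: lexord_lex lexord_take_index_conv)
  then show ?thesis using True by (simp add: lenlex_conv)
next
  case False
  then show ?thesis
    using kostka_length_le[OF assms(1,2)] by (simp add: lenlex_conv)
qed

section \<open>Hook shapes and examples of tableaux\<close>

text \<open>
  Reading the first row backwards and then continuing down the first column visits the cells of a hook
  in weakly increasing order of their entries, so that the filling is the sorted list of its letters.
\<close>

lemma hook_tableau_unique:
  assumes "\<alpha> = a # replicate k 1" "\<tau> \<in> SSRCT \<alpha>" "\<sigma> \<in> SSRCT \<alpha>"
    and weight: "tableau_weight \<alpha> \<tau> = tableau_weight \<alpha> \<sigma>"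
  shows "\<tau> = \<sigma>"
proof -
  \<comment> \<open>The cells in reading order.\<close>
  define cs :: "(nat \<times> nat) list"
    where "cs = map (\<lambda>j. (1, a - j)) [0..<a] @ map (\<lambda>i. (i + 2, 1)) [0..<k]"
  have mem: "(i, j) \<in> diagram \<alpha> \<longleftrightarrow> i = 1 \<and> 1 \<le> j \<and> j \<le> a \<or> 2 \<le> i \<and> i \<le> k + 1 \<and> j = 1" for i j
    by (auto simp: mem_diagram assms(1) nth_Cons' split: if_splits)
  have set_cs: "set cs = diagram \<alpha>"
  proof (rule set_eqI)
    fix c :: "nat \<times> nat"
    obtain i j where c: "c = (i, j)" by (cases c)
    have "(\<exists>x<a. j = a - x) \<longleftrightarrow> 1 \<le> j \<and> j \<le> a"
      by (auto intro: exI[of _ "a - j"])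
    moreover have "(\<exists>x<k. i = x + 2) \<longleftrightarrow> 2 \<le> i \<and> i \<le> k + 1"
      by (auto intro: exI[of _ "i - 2"])
    ultimately show "c \<in> set cs \<longleftrightarrow> c \<in> diagram \<alpha>"
      unfolding c mem by (auto simp: cs_def)
  qed
  have distinct: "distinct cs"
    by (auto simp: cs_def distinct_map inj_on_def)
  have sorted: "sorted (map \<rho> cs)" if \<rho>: "\<rho> \<in> SSRCT \<alpha>" for \<rho>
  proof -
    have "sorted_wrt (\<lambda>x y. \<rho> x \<le> \<rho> y) cs"
      unfolding cs_def sorted_wrt_append
    proof (intro conjI ballI)
      show "sorted_wrt (\<lambda>x y. \<rho> x \<le> \<rho> y) (map (\<lambda>j. (1, a - j)) [0..<a])"
        unfolding sorted_wrt_map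
        by (rule sorted_wrt_mono_rel[OF _ sorted_wrt_upt]) (auto intro!: SSRCT_row[OF \<rho>] simp: mem)
      show "sorted_wrt (\<lambda>x y. \<rho> x \<le> \<rho> y) (map (\<lambda>i. (i + 2, 1)) [0..<k])"
        unfolding sorted_wrt_map
        by (rule sorted_wrt_mono_rel[OF _ sorted_wrt_upt]) (auto intro!: less_imp_le SSRCT_column[OF \<rho>, unfolded One_nat_def] simp: mem)
      fix x y :: "nat \<times> nat"
      assume "x \<in> set (map (\<lambda>j. (1, a - j)) [0..<a])" "y \<in> set (map (\<lambda>i. (i + 2, 1 :: nat)) [0..<k])"
      then obtain j i where xy: "x = (1, a - j)" "j < a" "y = (i + 2, 1)" "i < k" by auto
      have "\<rho> x \<le> \<rho> (1, 1)"
        unfolding xy by (rule SSRCT_row[OF \<rho>]) (use xy in \<open>auto simp: mem\<close>)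
      also have "\<dots> < \<rho> y"
        unfolding xy by (rule SSRCT_column[OF \<rho>]) (use xy in \<open>auto simp: mem\<close>)
      finally show "\<rho> x \<le> \<rho> y" by simp
    qed
    then show ?thesis by (simp add: sorted_map)
  qed
  have count: "count (mset (map \<rho> cs)) s = Poly_Mapping.lookup (tableau_weight \<alpha> \<rho>) s" for \<rho> s
  proof -
    have "count (mset (map \<rho> cs)) s = card (set (filter (\<lambda>c. \<rho> c = s) cs))"
    proof -
      have "count_list (map \<rho> ds) s = length (filter (\<lambda>c. \<rho> c = s) ds)" for ds
        by (induction ds) auto
      then show ?thesis
        using distinct_card[OF distinct_filter[OF distinct, of "\<lambda>c. \<rho> c = s"]]
        by (simp only: count_mset)
    qed
    then show ?thesis
      by (simp add: set_cs lookup_tableau_weight)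
  qed
  have "mset (map \<tau> cs) = mset (map \<sigma> cs)"
    by (rule multiset_eqI) (simp only: count weight)
  then have "map \<tau> cs = map \<sigma> cs"
    using sorted[OF assms(2)] sorted[OF assms(3)] by (metis properties_for_sort)
  then have "\<tau> c = \<sigma> c" if "c \<in> diagram \<alpha>" for c
    using that set_cs by (metis map_eq_conv)
  then show ?thesis
    using SSRCT_outside[OF assms(2)] SSRCT_outside[OF assms(3)] by (metis ext)
qed

lemma kostka_hook:
  assumes "\<alpha> = a # replicate k 1" "kostka \<alpha> \<gamma> \<noteq> 0"
  shows "kostka \<alpha> \<gamma> = 1"
proof -
  obtain \<tau> where "\<tau> \<in> tableaux \<alpha> \<gamma>"
    using assms(2) unfolding kostka_neq_0_iff by blast
  moreover have "\<sigma> = \<sigma>'" if "\<sigma> \<in> tableaux \<alpha> \<gamma>" "\<sigma>' \<in> tableaux \<alpha> \<gamma>" for \<sigma> \<sigma>'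
    using hook_tableau_unique[OF assms(1), of \<sigma> \<sigma>'] that unfolding tableaux_def by simp
  ultimately have "tableaux \<alpha> \<gamma> = {\<tau>}" by blast
  then show ?thesis by (simp add: kostka_def)
qed

text \<open>
  The filling with given rows; lists are indexed from 0 and cells from 1.
\<close>

definition tableau_of_rows :: "nat list list \<Rightarrow> nat \<times> nat \<Rightarrow> nat"
  where "tableau_of_rows rows =
    (\<lambda>(i, j). if (i, j) \<in> diagram (map length rows) then rows ! (i - 1) ! (j - 1) else 0)"

lemma mem_diagram_rows:
  "(Suc i, Suc k) \<in> diagram (map length rows) \<longleftrightarrow> i < length rows \<and> k < length (rows ! i)"
  by (auto simp: mem_diagram)

lemma diagram_rowsE:
  assumes "(i, j) \<in> diagram (map length rows)"
  obtains i' k where "i = Suc i'" "j = Suc k" "i' < length rows" "k < length (rows ! i')"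
  using assms by (cases i; cases j) (auto simp: mem_diagram)

lemma tableau_of_rows_nth:
  "i < length rows \<Longrightarrow> k < length (rows ! i) \<Longrightarrow> tableau_of_rows rows (Suc i, Suc k) = rows ! i ! k"
  by (simp add: tableau_of_rows_def mem_diagram_rows)

lemma weight_of_rows:
  "tableau_weight (map length rows) (tableau_of_rows rows) = (\<Sum>x\<leftarrow>concat rows. Poly_Mapping.single x 1)"
proof -
  have concat: "(\<Sum>x\<leftarrow>concat rows. Poly_Mapping.single x (1 :: nat))
      = (\<Sum>row\<leftarrow>rows. \<Sum>x\<leftarrow>row. Poly_Mapping.single x 1)"
    by (induction rows) simp_all
  have "tableau_weight (map length rows) (tableau_of_rows rows)
    = (\<Sum>i=1..length rows. \<Sum>j=1..length (rows ! (i - 1)). Poly_Mapping.single (tableau_of_rows rows (i, j)) 1)"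
    unfolding tableau_weight_def diagram_Sigma by (subst sum.Sigma) (auto intro!: sum.cong)
  also have "\<dots> = (\<Sum>i<length rows. \<Sum>j<length (rows ! i). Poly_Mapping.single (rows ! i ! j) 1)"
    by (simp add: sum.atLeast1_atMost_eq tableau_of_rows_nth)
  also have "\<dots> = (\<Sum>row\<leftarrow>rows. \<Sum>x\<leftarrow>row. Poly_Mapping.single x 1)"
    by (simp add: sum_list_sum_nth atLeast0LessThan)
  finally show ?thesis unfolding concat .
qed

lemma kostka_rows:
  assumes "map length rows = \<alpha>"
    and pos: "\<And>row x. row \<in> set rows \<Longrightarrow> x \<in> set row \<Longrightarrow> 0 < x"
    and row: "\<And>row. row \<in> set rows \<Longrightarrow> sorted_wrt (\<ge>) row"
    and column: "\<And>i j. i < j \<Longrightarrow> j < length rows \<Longrightarrow> rows ! i \<noteq> [] \<Longrightarrow> rows ! j \<noteq> []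
      \<Longrightarrow> rows ! i ! 0 < rows ! j ! 0"
    and triple: "\<And>i j k. i < j \<Longrightarrow> j < length rows \<Longrightarrow> k < length (rows ! i) \<Longrightarrow> Suc k < length (rows ! j)
      \<Longrightarrow> rows ! j ! Suc k \<le> rows ! i ! k
      \<Longrightarrow> Suc k < length (rows ! i) \<and> rows ! j ! Suc k < rows ! i ! Suc k"
    and weight: "(\<Sum>x\<leftarrow>concat rows. Poly_Mapping.single x 1) = std_monom \<gamma>"
  shows "kostka \<alpha> \<gamma> \<noteq> 0"
proof -
  let ?\<tau> = "tableau_of_rows rows"
  have "?\<tau> \<in> SSRCT (map length rows)"
    unfolding SSRCT_def mem_Collect_eq
  proof (intro conjI allI impI ballI)
    fix c assume c: "c \<in> diagram (map length rows)"
    then obtain i k where "c = (Suc i, Suc k)" "i < length rows" "k < length (rows ! i)"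
      by (metis diagram_rowsE surj_pair)
    then show "0 < ?\<tau> c" using pos[of "rows ! i" "rows ! i ! k"] by (simp add: tableau_of_rows_nth)
  next
    fix c assume "c \<notin> diagram (map length rows)"
    then show "?\<tau> c = 0" by (auto simp: tableau_of_rows_def split: prod.split)
  next
    fix i j j'
    assume *: "(i, j) \<in> diagram (map length rows) \<and> (i, j') \<in> diagram (map length rows) \<and> j \<le> j'"
    then obtain i' k where k: "i = Suc i'" "j = Suc k" "i' < length rows" "k < length (rows ! i')"
      by (metis diagram_rowsE)
    from * obtain k' where k': "j' = Suc k'" "k' < length (rows ! i')"
      using k(1) by (metis diagram_rowsE nat.inject)
    have "rows ! i' ! k' \<le> rows ! i' ! k"
      using sorted_wrt_nth_less[OF row[of "rows ! i'"], of k k'] k k' * by (cases "k = k'") auto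
    then show "?\<tau> (i, j') \<le> ?\<tau> (i, j)"
      using k k' by (simp add: tableau_of_rows_nth)
  next
    fix i i'
    assume *: "(i, 1) \<in> diagram (map length rows) \<and> (i', 1) \<in> diagram (map length rows) \<and> i < i'"
    then obtain p q where "i = Suc p" "i' = Suc q"
      by (metis diagram_rowsE)
    then show "?\<tau> (i, 1) < ?\<tau> (i', 1)"
      using * column[of p q] by (auto simp: mem_diagram_rows tableau_of_rows_nth)
  next
    fix i j k
    assume *: "i < j \<and> (i, k) \<in> diagram (map length rows) \<and> (j, k + 1) \<in> diagram (map length rows)
      \<and> ?\<tau> (j, k + 1) \<le> ?\<tau> (i, k)"
    then obtain p q r where "i = Suc p" "j = Suc q" "k = Suc r"
      by (metis diagram_rowsE)
    then show "(i, k + 1) \<in> diagram (map length rows)" and "?\<tau> (j, k + 1) < ?\<tau> (i, k + 1)"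
      using * triple[of p q r] by (auto simp: mem_diagram_rows tableau_of_rows_nth)
  qed
  moreover have "tableau_weight (map length rows) ?\<tau> = std_monom \<gamma>"
    unfolding weight_of_rows by (rule weight)
  ultimately have "?\<tau> \<in> tableaux \<alpha> \<gamma>"
    unfolding tableaux_def assms(1) by blast
  then show ?thesis
    unfolding kostka_neq_0_iff by blast
qed

lemma sum_list_replicate_single:
  "(\<Sum>x\<leftarrow>replicate n s. Poly_Mapping.single x (1 :: nat)) = Poly_Mapping.single s n"
  by (induction n) (simp_all flip: single_add)

lemma std_monom_eq: "std_monom \<gamma> = (\<Sum>i\<leftarrow>[0..<length \<gamma>]. Poly_Mapping.single (Suc i) (\<gamma> ! i))"
proof -
  have "zip [1..<Suc (length \<gamma>)] \<gamma> = map (\<lambda>i. (Suc i, \<gamma> ! i)) [0..<length \<gamma>]"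
    by (rule nth_equalityI) (simp_all del: upt_Suc)
  then show ?thesis
    unfolding power_monom_def by (simp add: o_def del: upt_Suc)
qed

lemma sorted_wrt_replicate_ge: "sorted_wrt (\<ge>) (replicate n (s :: nat))"
  by (induction n) auto

text \<open>
  Fill row \<open>i\<close> with copies of \<open>i\<close>.
\<close>

lemma kostka_refl: "kostka \<alpha> \<alpha> \<noteq> 0"
proof (rule kostka_rows)
  let ?rows = "map (\<lambda>i. replicate (\<alpha> ! i) (Suc i)) [0..<length \<alpha>]"
  show "map length ?rows = \<alpha>"
    by (simp add: o_def map_nth)
  have "(\<Sum>x\<leftarrow>concat (map (\<lambda>i. replicate (\<alpha> ! i) (Suc i)) is). Poly_Mapping.single x (1 :: nat))
      = (\<Sum>i\<leftarrow>is. Poly_Mapping.single (Suc i) (\<alpha> ! i))" for "is"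
    by (induction "is") (simp_all add: sum_list_replicate_single del: map_replicate sum_list_replicate One_nat_def)
  then show "(\<Sum>x\<leftarrow>concat ?rows. Poly_Mapping.single x 1) = std_monom \<alpha>"
    unfolding std_monom_eq .
qed (auto simp: sorted_wrt_iff_nth_less)

lemma kostka_one_row_two_letters: "kostka [a + b] [a, b] \<noteq> 0"
proof (rule kostka_rows)
  show "map length [replicate b 2 @ replicate a (1 :: nat)] = [a + b]" by simp
  show "(\<Sum>x\<leftarrow>concat [replicate b 2 @ replicate a 1]. Poly_Mapping.single x 1) = std_monom [a, b]"
    unfolding std_monom_eq
    by (simp add: sum_list_replicate_single add.commute numeral_2_eq_2 del: map_replicate sum_list_replicate One_nat_def)
      (simp only: One_nat_def)
qed (auto simp: sorted_wrt_append sorted_wrt_replicate_ge)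

text \<open>
  Here the letter 1 occurs in both rows.  Row 1 being a single cell, the triple condition only compares
  \<open>(1, 1)\<close> with \<open>(2, 2)\<close>, and the latter has the larger entry.
\<close>

lemma kostka_13_22: "kostka [1, 3] [2, 2] \<noteq> 0"
proof (rule kostka_rows[of "[[1], [2, 2, 1]]"])
  show "(\<Sum>x\<leftarrow>concat [[1], [2, 2, 1]]. Poly_Mapping.single x 1) = std_monom [2, 2]"
    unfolding std_monom_eq
    by (rule poly_mapping_eqI) (auto simp: lookup_add lookup_single when_def)
qed (auto simp: less_Suc_eq nth_Cons')

lemma kostka_31_211: "kostka [3, 1] [2, 1, 1] \<noteq> 0"
proof (rule kostka_rows[of "[[2, 1, 1], [3]]"])
  show "(\<Sum>x\<leftarrow>concat [[2, 1, 1], [3]]. Poly_Mapping.single x 1) = std_monom [2, 1, 1]"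
    unfolding std_monom_eq
    by (rule poly_mapping_eqI) (auto simp: lookup_add lookup_single when_def)
qed (auto simp: less_Suc_eq nth_Cons')

lemma kostka_211_1111: "kostka [2, 1, 1] [1, 1, 1, 1] \<noteq> 0"
proof (rule kostka_rows[of "[[2, 1], [3], [4]]"])
  show "(\<Sum>x\<leftarrow>concat [[2, 1], [3], [4]]. Poly_Mapping.single x 1) = std_monom [1, 1, 1, 1]"
    unfolding std_monom_eq
    by (rule poly_mapping_eqI) (auto simp: lookup_add lookup_single when_def)
qed (auto simp: less_Suc_eq nth_Cons')

lemma kostka_degree_2:
  "kostka [2] [2] = 1" "kostka [2] [1, 1] = 1" "kostka [1, 1] [2] = 0" "kostka [1, 1] [1, 1] = 1"
proof -
  show "kostka [2] [2] = 1" "kostka [1, 1] [1, 1] = 1"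
    using kostka_hook[OF _ kostka_refl, of "[2]" 2 0] kostka_hook[OF _ kostka_refl, of "[1, 1]" 1 1] by auto
  show "kostka [2] [1, 1] = 1"
    using kostka_hook[of "[2]" 2 0 "[1, 1]"] kostka_one_row_two_letters[of 1 1] by (simp add: numeral_2_eq_2)
  show "kostka [1, 1] [2] = 0"
    by (rule ccontr) (use kostka_length_le[of "[1, 1]" "[2]"] in simp)
qed

lemma kostka_211_support:
  assumes "\<delta> \<in> comps 4" "kostka [2, 1, 1] \<delta> \<noteq> 0"
  shows "\<delta> = [2, 1, 1] \<or> \<delta> = [1, 1, 1, 1]"
proof -
  note \<delta> = compsD[OF assms(1)]
  have "3 \<le> length \<delta>" using kostka_length_le[OF assms(2)] by simp
  moreover have "length \<delta> \<le> 4" using length_le_sum_list_composition \<delta> by metis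
  ultimately consider "length \<delta> = 3" | "length \<delta> = 4" by linarith
  then show ?thesis
  proof cases
    case 1
    then have "\<delta> ! 0 \<noteq> 1" using kostka_parts_1[OF assms(2), of 0] by auto
    then show ?thesis using 1 \<delta> by (auto simp: numeral_3_eq_3 length_Suc_conv)
  next
    case 2
    then show ?thesis using \<delta> by (auto simp: eval_nat_numeral length_Suc_conv)
  qed
qed

lemma kostka_hook_211: "kostka [2, 1, 1] [2, 1, 1] = 1" "kostka [2, 1, 1] [1, 1, 1, 1] = 1"
  using kostka_hook[of "[2, 1, 1]" 2 2] kostka_refl[of "[2, 1, 1]"] kostka_211_1111
  by (simp_all add: numeral_2_eq_2)

text \<open>
  Contents \<open>(1, n-1)\<close> and \<open>(n-1, 1)\<close> occur in shape \<open>(n)\<close>.  If they occur in another shape, that shape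
  has two rows, and each row has a single cell because one of the contents has 1 in its place; hence \<open>n = 2\<close>.
\<close>

lemma kostka_not_like_one_row:
  assumes "3 \<le> n" "\<delta> \<in> comps n" "\<delta> \<noteq> [n]"
    and same: "\<And>\<gamma>. \<gamma> \<in> comps n \<Longrightarrow> \<gamma> \<noteq> [n] \<Longrightarrow> kostka \<delta> \<gamma> = kostka [n] \<gamma>"
  shows False
proof -
  note \<delta> = compsD[OF assms(2)]
  have K: "kostka \<delta> [1, n - 1] \<noteq> 0" "kostka \<delta> [n - 1, 1] \<noteq> 0"
    using kostka_one_row_two_letters[of 1 "n - 1"] kostka_one_row_two_letters[of "n - 1" 1]
      same[of "[1, n - 1]"] same[of "[n - 1, 1]"] assms(1) by (auto simp: comps_def)
  have "length \<delta> \<le> 2" using kostka_length_le[OF K(1) \<delta>(1)] by simp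
  moreover have "\<delta> \<noteq> []" using \<delta> assms(1) by auto
  moreover have "length \<delta> \<noteq> 1" using \<delta> assms(3) by (auto simp: length_Suc_conv)
  ultimately have len: "length \<delta> = 2"
    using le_neq_implies_less[of "length \<delta>" 2] by (auto simp: less_2_cases_iff)
  have "\<delta> ! 0 = 1" using kostka_parts_1[OF K(1) \<delta>(1), of 0] len by simp
  moreover have "\<delta> ! 1 = 1" using kostka_parts_1[OF K(2) \<delta>(1), of 1] len by simp
  ultimately have "sum_list \<delta> = 2" using len by (auto simp: numeral_2_eq_2 length_Suc_conv)
  then show False using \<delta>(2) assms(1) by simp
qed

lemma one_row_if_kostka: "\<alpha> \<in> comps n \<Longrightarrow> 0 < n \<Longrightarrow> kostka \<alpha> [n] \<noteq> 0 \<Longrightarrow> \<alpha> = [n]"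
  using kostka_length_le[of \<alpha> "[n]"] by (cases \<alpha>) (auto simp: comps_def)

section \<open>The action on quasisymmetric Schur functions\<close>

lemma qschur_expansion:
  assumes "\<alpha> \<in> comps n"
  shows "qschur \<alpha> = (\<Sum>\<delta>\<in>comps n. scale (of_nat (kostka \<alpha> \<delta>)) (M_qsym \<delta>))"
proof -
  have "qschur \<alpha> = (\<Sum>\<delta>\<in>comps n. scale (M_coeff (qschur \<alpha>) \<delta>) (M_qsym \<delta>))"
    using sum_list_eq_if_kostka assms
    by (intro M_expansion qschur_in_QSym finite_comps) (auto simp: comps_def M_coeff_qschur)
  then show ?thesis by (simp only: M_coeff_qschur)
qed

lemma coeff_qschur_expansion:
  assumes "\<alpha> \<in> comps n"
  shows "M_coeff (qschur \<alpha>) \<gamma> = (\<Sum>\<delta>\<in>comps n. of_nat (kostka \<alpha> \<delta>) * M_coeff (M_qsym \<delta>) \<gamma>)"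
  unfolding qschur_expansion[OF assms] by (simp only: M_coeff_sum M_coeff_scale)

lemma qschur_in_QSym_hom: "\<alpha> \<in> comps n \<Longrightarrow> qschur \<alpha> \<in> QSym_hom n"
  unfolding qschur_expansion
  by (unfold QSym_hom_def, intro coeffs.span_sum coeffs.span_scale coeffs.span_base) (auto simp: comps_def)

lemma qschur_eqI:
  assumes "\<alpha> \<in> comps n" "\<beta> \<in> comps n" "\<And>\<gamma>. \<gamma> \<in> comps n \<Longrightarrow> kostka \<alpha> \<gamma> = kostka \<beta> \<gamma>"
  shows "qschur \<alpha> = qschur \<beta>"
  unfolding qschur_expansion[OF assms(1)] qschur_expansion[OF assms(2)]
  using assms(3) by (intro sum.cong) auto

lemma identity_graded_coalgebra_automorphism:
  assumes "\<forall>q\<in>QSym. f q = q"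
  shows "graded_coalgebra_automorphism_QSym f"
proof -
  have closed: "u + v \<in> QSym" "scale c u \<in> QSym" if "u \<in> QSym" "v \<in> QSym" for u v c
    using subspace_QSym that by (auto simp: coeffs.subspace_def)
  have "linear_on QSym f"
    unfolding linear_on_def using assms closed by simp
  moreover have "is_tensor_map QSym QSym f f id"
    using assms by (simp add: is_tensor_map_def linear_on_def)
  moreover have "f ` QSym_hom n \<subseteq> QSym_hom n" for n
    using assms QSym_hom_subset[of n] by (auto simp: subset_iff)
  moreover have "bij_betw f QSym QSym"
    using assms by (metis bij_betw_cong bij_betw_id id_apply)
  ultimately show ?thesis
    using assms
    unfolding graded_coalgebra_automorphism_QSym_def coalgebra_hom_QSym_def graded_QSym_def
    by (auto intro!: exI[of _ id])
qed

context graded_coalgebra_endo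
begin

lemma coeff_expansion:
  assumes "\<alpha> \<in> comps n"
  shows "M_coeff (f (qschur \<alpha>)) \<gamma> = (\<Sum>\<delta>\<in>comps n. of_nat (kostka \<alpha> \<delta>) * M_coeff (f (M_qsym \<delta>)) \<gamma>)"
proof -
  have "f (qschur \<alpha>) = (\<Sum>\<delta>\<in>comps n. scale (of_nat (kostka \<alpha> \<delta>)) (f (M_qsym \<delta>)))"
    unfolding qschur_expansion[OF assms]
    by (rule linear_on_sum[OF subspace_QSym linear finite_comps]) (auto dest: compsD intro: M_qsym_in_QSym)
  then show ?thesis by (simp only: M_coeff_sum M_coeff_scale)
qed

text \<open>
  Induction downwards along the triangularity of the Kostka numbers: in the expansion of \<open>qschur \<gamma>\<close> all
  terms other than \<open>M_qsym \<gamma>\<close> belong to compositions after \<open>\<gamma>\<close> and are already fixed.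
\<close>

lemma fixes_M_if_fixes_qschur:
  assumes "\<And>\<alpha>. \<alpha> \<in> comps n \<Longrightarrow> f (qschur \<alpha>) = qschur \<alpha>" and "\<gamma> \<in> comps n"
  shows "f (M_qsym \<gamma>) = M_qsym \<gamma>"
proof -
  define R where "R = {(\<delta>, \<gamma>). \<delta> \<in> comps n \<and> \<gamma> \<in> comps n \<and> (\<gamma>, \<delta>) \<in> lenlex less_than}"
  have "finite R"
    by (rule finite_subset[of _ "comps n \<times> comps n"]) (auto simp: R_def finite_comps)
  moreover have "acyclic ((lenlex (less_than :: nat rel))\<inverse>)"
    by (simp add: wf_acyclic wf_lenlex)
  then have "acyclic R"
    by (rule acyclic_subset) (auto simp: R_def)
  ultimately have "wf R" by (rule finite_acyclic_wf)
  then show ?thesis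
    using assms(2)
  proof (induction \<gamma> rule: wf_induct_rule)
    case (less \<gamma>)
    note \<gamma> = compsD[OF less.prems]
    show ?case
    proof (rule QSym_eqI)
      show "f (M_qsym \<gamma>) \<in> QSym" "M_qsym \<gamma> \<in> QSym"
        using maps_QSym M_qsym_in_QSym \<gamma> by auto
    next
      fix \<eta> :: "nat list"
      let ?d = "\<lambda>\<delta>. M_coeff (f (M_qsym \<delta>)) \<eta> - M_coeff (M_qsym \<delta>) \<eta>"
      have "(\<Sum>\<delta>\<in>comps n. of_nat (kostka \<gamma> \<delta>) * ?d \<delta>)
          = M_coeff (f (qschur \<gamma>)) \<eta> - M_coeff (qschur \<gamma>) \<eta>"
        unfolding coeff_expansion[OF less.prems]
          coeff_qschur_expansion[OF less.prems]
        by (simp only: right_diff_distrib sum_subtractf)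
      also have "\<dots> = 0" using assms(1)[OF less.prems] by simp
      also have "(\<Sum>\<delta>\<in>comps n. of_nat (kostka \<gamma> \<delta>) * ?d \<delta>) = of_nat (kostka \<gamma> \<gamma>) * ?d \<gamma>"
      proof (rule sum.remove[OF finite_comps less.prems, THEN trans], simp, rule sum.neutral, intro ballI)
        fix \<delta> assume \<delta>: "\<delta> \<in> comps n - {\<gamma>}"
        show "of_nat (kostka \<gamma> \<delta>) * ?d \<delta> = 0"
        proof (cases "kostka \<gamma> \<delta> = 0")
          case False
          then have "(\<delta>, \<gamma>) \<in> R"
            using kostka_lenlex[OF False \<gamma>(1)] \<delta> less.prems by (auto simp: R_def)
          then have "f (M_qsym \<delta>) = M_qsym \<delta>" using less.IH \<delta> by blast
          then show ?thesis by simp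
        qed simp
      qed
      finally show "M_coeff (f (M_qsym \<gamma>)) \<eta> = M_coeff (M_qsym \<gamma>) \<eta>"
        using kostka_refl by simp
    qed
  qed
qed

text \<open>
  In the coproduct of an element of degree \<open>n\<close>, the components with two factors of positive degree
  involve degrees below \<open>n\<close> only; there \<open>f\<close> acts like the identity, which is a morphism itself.
\<close>

lemma coeff_append_if_fixes_below:
  assumes below: "\<And>\<delta>. \<delta> \<in> compositions \<Longrightarrow> sum_list \<delta> < n \<Longrightarrow> f (M_qsym \<delta>) = M_qsym \<delta>"
    and \<alpha>: "\<alpha> \<in> comps n" and "\<beta> \<in> compositions" "\<gamma> \<in> compositions" "\<beta> \<noteq> []" "\<gamma> \<noteq> []"
  shows "M_coeff (f (M_qsym \<alpha>)) (\<beta> @ \<gamma>) = M_coeff (M_qsym \<alpha>) (\<beta> @ \<gamma>)"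
proof -
  interpret id: graded_coalgebra_endo "\<lambda>q. q"
    using identity_graded_coalgebra_automorphism[of "\<lambda>q. q"]
    by unfold_locales (simp_all add: graded_coalgebra_automorphism_QSym_def)
  note \<alpha>' = compsD[OF \<alpha>]
  have pos: "0 < sum_list \<beta>" "0 < sum_list \<gamma>"
    using assms(3-6) sum_list_composition_eq_0 by blast+
  have "M_coeff (f (M_qsym (take i \<alpha>))) \<beta> * M_coeff (f (M_qsym (drop i \<alpha>))) \<gamma>
      = M_coeff (M_qsym (take i \<alpha>)) \<beta> * M_coeff (M_qsym (drop i \<alpha>)) \<gamma>" for i
  proof -
    have comp: "take i \<alpha> \<in> compositions" "drop i \<alpha> \<in> compositions"
      using \<alpha>'(1) by (metis append_take_drop_id composition_simps(3))+
    have sum: "sum_list (take i \<alpha>) + sum_list (drop i \<alpha>) = n"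
      using \<alpha>'(2) by (metis append_take_drop_id sum_list_append)
    show ?thesis
    proof (cases "sum_list (take i \<alpha>) = sum_list \<beta> \<and> sum_list (drop i \<alpha>) = sum_list \<gamma>")
      case True
      then show ?thesis using below[OF comp(1)] below[OF comp(2)] sum pos by simp
    next
      case False
      then show ?thesis
        using coeff_other_degree[OF comp(1) assms(3)] coeff_other_degree[OF comp(2) assms(4)]
          id.coeff_other_degree[OF comp(1) assms(3)] id.coeff_other_degree[OF comp(2) assms(4)]
        by auto
    qed
  qed
  then show ?thesis
    unfolding coeff_append[OF \<alpha>'(1) assms(3,4)] id.coeff_append[OF \<alpha>'(1) assms(3,4)] by simp
qed

end

section \<open>Rigidity\<close>

locale qschur_preserving = graded_coalgebra_endo +
  assumes inj: "inj_on f QSym"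
    and preserves: "\<alpha> \<in> compositions \<Longrightarrow> \<exists>\<beta>\<in>compositions. f (qschur \<alpha>) = qschur \<beta>"
begin

lemma image_qschur:
  assumes "\<alpha> \<in> comps n"
  obtains \<beta> where "\<beta> \<in> comps n" "f (qschur \<alpha>) = qschur \<beta>"
proof -
  obtain \<beta> where \<beta>: "\<beta> \<in> compositions" "f (qschur \<alpha>) = qschur \<beta>"
    using preserves compsD(1)[OF assms] by blast
  have "qschur \<beta> \<in> QSym_hom n"
    using graded qschur_in_QSym_hom[OF assms] \<beta>(2) unfolding graded_QSym_def by (metis image_subset_iff)
  then have "sum_list \<beta> = n"
    using QSym_hom_coeff[OF _ \<beta>(1)] kostka_refl by (metis M_coeff_qschur of_nat_eq_0_iff)
  then show ?thesis using that \<beta> by (simp add: comps_def)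
qed

text \<open>
  Thus the image of \<open>qschur \<alpha>\<close> differs from it only by a multiple of \<open>M_qsym [n]\<close>.
\<close>

lemma kostka_image_eq:
  assumes below: "\<And>\<delta>. \<delta> \<in> compositions \<Longrightarrow> sum_list \<delta> < n \<Longrightarrow> f (M_qsym \<delta>) = M_qsym \<delta>"
    and "\<alpha> \<in> comps n" "\<beta> \<in> comps n" "f (qschur \<alpha>) = qschur \<beta>"
    and \<gamma>: "\<gamma> \<in> comps n" "\<gamma> \<noteq> [n]" "0 < n"
  shows "kostka \<beta> \<gamma> = kostka \<alpha> \<gamma>"
proof -
  obtain a \<gamma>' where split: "\<gamma> = [a] @ \<gamma>'" "\<gamma>' \<noteq> []"
  proof (cases \<gamma>)
    case (Cons a \<gamma>')
    have "\<gamma>' \<noteq> []" using \<gamma> Cons by (auto simp: comps_def)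
    then show ?thesis using that Cons by simp
  qed (use \<gamma> in \<open>simp add: comps_def\<close>)
  then have comp: "[a] \<in> compositions" "\<gamma>' \<in> compositions"
    using \<gamma>(1) by (auto simp: comps_def)
  have "M_coeff (f (qschur \<alpha>)) \<gamma> = (\<Sum>\<delta>\<in>comps n. of_nat (kostka \<alpha> \<delta>) * M_coeff (M_qsym \<delta>) \<gamma>)"
    unfolding coeff_expansion[OF assms(2)] split(1)
    using coeff_append_if_fixes_below[OF below _ comp _ split(2)] by (intro sum.cong) auto
  also have "\<dots> = M_coeff (qschur \<alpha>) \<gamma>"
    by (rule coeff_qschur_expansion[OF assms(2), symmetric])
  finally show ?thesis
    using assms(4) by (simp add: M_coeff_qschur)
qed

lemma fixes_qschur_step:
  assumes below: "\<And>\<delta>. \<delta> \<in> compositions \<Longrightarrow> sum_list \<delta> < n \<Longrightarrow> f (M_qsym \<delta>) = M_qsym \<delta>"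
    and "n \<noteq> 2" and \<alpha>: "\<alpha> \<in> comps n"
  shows "f (qschur \<alpha>) = qschur \<alpha>"
proof -
  obtain \<beta> where \<beta>: "\<beta> \<in> comps n" "f (qschur \<alpha>) = qschur \<beta>"
    by (rule image_qschur[OF \<alpha>])
  show ?thesis
  proof (cases "\<alpha> = \<beta>")
    case False
    have "3 \<le> n"
    proof (rule ccontr)
      assume "\<not> 3 \<le> n"
      then consider "n = 0" | "n = 1" using \<open>n \<noteq> 2\<close> by linarith
      then have "\<exists>\<eta>. comps n \<subseteq> {\<eta>}"
      proof cases
        case 1
        then show ?thesis using sum_list_composition_eq_0 by (auto simp: comps_def)
      next
        case 2
        have "\<eta> = [1]" if "\<eta> \<in> comps 1" for \<eta>
          using that by (cases \<eta>; cases "tl \<eta>") (auto simp: comps_def)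
        with 2 show ?thesis by blast
      qed
      with \<alpha> \<beta>(1) False show False by blast
    qed
    then have "0 < n" by simp
    have same: "kostka \<beta> \<gamma> = kostka \<alpha> \<gamma>" if "\<gamma> \<in> comps n" "\<gamma> \<noteq> [n]" for \<gamma>
      by (rule kostka_image_eq[OF below \<alpha> \<beta> that \<open>0 < n\<close>])
    have "\<alpha> \<noteq> [n]" "\<beta> \<noteq> [n]"
      using kostka_not_like_one_row[OF \<open>3 \<le> n\<close>, of \<beta>] kostka_not_like_one_row[OF \<open>3 \<le> n\<close>, of \<alpha>] same \<alpha> \<beta>(1) False
      by auto
    then have "kostka \<beta> \<gamma> = kostka \<alpha> \<gamma>" if "\<gamma> \<in> comps n" for \<gamma>
      using same[OF that] one_row_if_kostka[OF \<alpha> \<open>0 < n\<close>] one_row_if_kostka[OF \<beta>(1) \<open>0 < n\<close>]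
      by (cases "\<gamma> = [n]") (auto, metis gr0I)
    then have "qschur \<beta> = qschur \<alpha>" by (rule qschur_eqI[OF \<beta>(1) \<alpha>])
    with \<beta>(2) show ?thesis by simp
  qed (use \<beta> in simp)
qed

text \<open>
  By injectivity, \<open>f\<close> exchanges \<open>qschur [2] = M_qsym [2] + M_qsym [1, 1]\<close> and
  \<open>qschur [1, 1] = M_qsym [1, 1]\<close>.
\<close>

lemma swap_in_degree_2_coeffs:
  assumes "\<And>\<delta>. \<delta> \<in> compositions \<Longrightarrow> sum_list \<delta> < 2 \<Longrightarrow> f (M_qsym \<delta>) = M_qsym \<delta>"
    and "\<alpha> \<in> comps 2" "f (qschur \<alpha>) \<noteq> qschur \<alpha>"
  shows "M_coeff (f (M_qsym [1, 1])) [2] = 1" "M_coeff (f (M_qsym [2])) [2] = -1"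
proof -
  have comps: "[2] \<in> comps 2" "[1, 1] \<in> comps 2" by (simp_all add: comps_2)
  have "M_coeff (qschur [2]) [2] \<noteq> M_coeff (qschur [1, 1]) [2]"
    unfolding M_coeff_qschur kostka_degree_2 by simp
  then have "qschur [2] \<noteq> qschur [1, 1]" by auto
  then have "f (qschur [2]) \<noteq> f (qschur [1, 1])"
    using inj qschur_in_QSym by (simp add: inj_on_eq_iff)
  moreover have "f (qschur [2]) \<in> {qschur [2], qschur [1, 1]}" "f (qschur [1, 1]) \<in> {qschur [2], qschur [1, 1]}"
    using image_qschur[OF comps(1)] image_qschur[OF comps(2)] comps_2 by (metis insert_iff empty_iff)+
  moreover have "\<alpha> = [2] \<or> \<alpha> = [1, 1]" using assms(2) by (simp add: comps_2)
  ultimately have swap: "f (qschur [2]) = qschur [1, 1]" "f (qschur [1, 1]) = qschur [2]"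
    using assms(3) by auto
  have sum: "(\<Sum>\<delta>\<in>comps 2. g \<delta>) = g [2] + g [1, 1]" for g :: "nat list \<Rightarrow> rat"
    by (simp add: comps_2)
  show 1: "M_coeff (f (M_qsym [1, 1])) [2] = 1"
    using coeff_expansion[OF comps(2), of "[2]"] swap(2) unfolding sum
    by (simp add: M_coeff_qschur kostka_degree_2 del: One_nat_def)
  show "M_coeff (f (M_qsym [2])) [2] = -1"
    using coeff_expansion[OF comps(1), of "[2]"] swap(1) 1 unfolding sum
    by (simp add: M_coeff_qschur kostka_degree_2 del: One_nat_def)
qed

text \<open>
  The coefficients of \<open>f (qschur [2, 1, 1])\<close> follow from those in degrees 1 and 2 by splitting
  compositions.  Compositions containing a part 3 or 4 are out of reach of this computation, because
  the action of \<open>f\<close> on primitive elements of these degrees is unknown at this stage.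
\<close>

lemma fixes_qschur_degree_2:
  assumes below: "\<And>\<delta>. \<delta> \<in> compositions \<Longrightarrow> sum_list \<delta> < 2 \<Longrightarrow> f (M_qsym \<delta>) = M_qsym \<delta>"
    and \<alpha>: "\<alpha> \<in> comps 2"
  shows "f (qschur \<alpha>) = qschur \<alpha>"
proof (rule ccontr)
  assume swap: "f (qschur \<alpha>) \<noteq> qschur \<alpha>"
  note phi2 = swap_in_degree_2_coeffs[OF below \<alpha> swap]
  have phi1: "M_coeff (f (M_qsym [1])) [1] = 1"
    using below[of "[1]"] by (simp add: M_coeff_M)
  have mem: "[2, 1, 1] \<in> comps 4" "[1, 1, 1, 1] \<in> comps 4" by (simp_all add: comps_def)
  have coeff: "M_coeff (f (qschur [2, 1, 1])) \<gamma>
      = M_coeff (f (M_qsym [2, 1, 1])) \<gamma> + M_coeff (f (M_qsym [1, 1, 1, 1])) \<gamma>" for \<gamma>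
  proof -
    have "M_coeff (f (qschur [2, 1, 1])) \<gamma>
      = (\<Sum>\<delta>\<in>{[2, 1, 1], [1, 1, 1, 1]}. of_nat (kostka [2, 1, 1] \<delta>) * M_coeff (f (M_qsym \<delta>)) \<gamma>)"
      unfolding coeff_expansion[OF mem(1)]
      using mem kostka_211_support by (intro sum.mono_neutral_right finite_comps) auto
    then show ?thesis using kostka_hook_211 by simp
  qed
  have phi: "M_coeff (f (M_qsym [2])) [1, 1] = 0" "M_coeff (f (M_qsym [1, 1])) [1, 1] = 1"
    using coeff_append[of _ "[1]" "[1]"] by (simp_all add: coeff_other_degree phi1 atMost_Suc del: One_nat_def)
  have phi3: "M_coeff (f (M_qsym [1, 1, 1])) [2, 1] = 1" "M_coeff (f (M_qsym [1, 1, 1])) [1, 1] = 0"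
    using coeff_append[of "[1, 1, 1]" "[2]" "[1]"]
    by (simp_all add: coeff_other_degree phi1 phi2 atMost_Suc del: One_nat_def)
  obtain \<beta> where \<beta>: "\<beta> \<in> comps 4" "f (qschur [2, 1, 1]) = qschur \<beta>"
    by (rule image_qschur[OF mem(1)])
  note \<beta>' = compsD[OF \<beta>(1)]
  have "M_coeff (f (qschur [2, 1, 1])) [2, 2] = 0"
    unfolding coeff using coeff_append[of _ "[2]" "[2]"]
    by (simp add: coeff_other_degree phi1 phi2 atMost_Suc del: One_nat_def)
  then have K22: "kostka \<beta> [2, 2] = 0" unfolding \<beta>(2) M_coeff_qschur by simp
  have "M_coeff (f (qschur [2, 1, 1])) [2, 1, 1] = 0"
    unfolding coeff using coeff_append[of _ "[2]" "[1, 1]"]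
    by (simp add: coeff_other_degree phi1 phi2 phi atMost_Suc del: One_nat_def)
  then have K211: "kostka \<beta> [2, 1, 1] = 0" unfolding \<beta>(2) M_coeff_qschur by simp
  have "M_coeff (f (qschur [2, 1, 1])) [1, 2, 1] = 1"
    unfolding coeff using coeff_append[of _ "[1]" "[2, 1]"]
    by (simp add: coeff_other_degree phi1 phi2 phi3 atMost_Suc del: One_nat_def)
  then have K121: "kostka \<beta> [1, 2, 1] \<noteq> 0" unfolding \<beta>(2) M_coeff_qschur by (metis of_nat_0 zero_neq_one)
  have "M_coeff (f (qschur [2, 1, 1])) [1, 1, 2] = 1"
    unfolding coeff using coeff_append[of _ "[1, 1]" "[2]"]
    by (simp add: coeff_other_degree phi1 phi2 phi atMost_Suc del: One_nat_def)
  then have K112: "kostka \<beta> [1, 1, 2] \<noteq> 0" unfolding \<beta>(2) M_coeff_qschur by (metis of_nat_0 zero_neq_one)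
  have "length \<beta> \<le> 3" using kostka_length_le[OF K121 \<beta>'(1)] by simp
  moreover have "length \<beta> \<noteq> 3"
  proof
    assume len: "length \<beta> = 3"
    have "\<beta> ! 0 = 1" "\<beta> ! 1 = 1" "\<beta> ! 2 = 1"
      using kostka_parts_1[OF K121 \<beta>'(1), of 0] kostka_parts_1[OF K112 \<beta>'(1), of 1]
        kostka_parts_1[OF K121 \<beta>'(1), of 2] len by simp_all
    then show False using len \<beta>'(2) by (auto simp: numeral_3_eq_3 length_Suc_conv)
  qed
  ultimately consider "length \<beta> = 0" | "length \<beta> = 1" | "length \<beta> = 2" by linarith
  then have "\<beta> \<in> {[4], [1, 3], [2, 2], [3, 1]}"
  proof cases
    case 3
    then show ?thesis using \<beta>' by (auto simp: numeral_2_eq_2 length_Suc_conv)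
  qed (use \<beta>' in \<open>auto simp: length_Suc_conv\<close>)
  moreover have "kostka [4] [2, 2] \<noteq> 0" using kostka_one_row_two_letters[of 2 2] by simp
  ultimately show False
    using K22 K211 kostka_13_22 kostka_31_211 kostka_refl[of "[2, 2]"] by auto
qed

lemma fixes_M:
  assumes "\<alpha> \<in> compositions"
  shows "f (M_qsym \<alpha>) = M_qsym \<alpha>"
  using assms
proof (induction "sum_list \<alpha>" arbitrary: \<alpha> rule: less_induct)
  case less
  then have "f (qschur \<beta>) = qschur \<beta>" if "\<beta> \<in> comps (sum_list \<alpha>)" for \<beta>
    using that fixes_qschur_degree_2[of \<beta>] fixes_qschur_step[of "sum_list \<alpha>" \<beta>]
    by (cases "sum_list \<alpha> = 2") auto
  then show ?case
    using less.prems by (intro fixes_M_if_fixes_qschur) (auto simp: comps_def)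
qed

lemma identity_on_QSym:
  assumes "q \<in> QSym"
  shows "f q = q"
proof -
  let ?A = "{\<alpha> \<in> compositions. M_coeff q \<alpha> \<noteq> 0}"
  have q: "q = (\<Sum>\<alpha>\<in>?A. scale (M_coeff q \<alpha>) (M_qsym \<alpha>))"
    using assms finite_M_coeff by (intro M_expansion) auto
  have "f q = (\<Sum>\<alpha>\<in>?A. scale (M_coeff q \<alpha>) (f (M_qsym \<alpha>)))"
    by (subst q, rule linear_on_sum[OF subspace_QSym linear finite_M_coeff[OF assms]])
      (auto intro: M_qsym_in_QSym)
  also have "\<dots> = (\<Sum>\<alpha>\<in>?A. scale (M_coeff q \<alpha>) (M_qsym \<alpha>))"
    by (intro sum.cong) (auto simp: fixes_M)
  finally show ?thesis using q by simp
qed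

end

theorem proposition6p6:
  fixes f :: "series \<Rightarrow> series"
  shows "graded_coalgebra_automorphism_QSym f \<and>
      f ` {qschur \<alpha> | \<alpha>. \<alpha> \<in> compositions} = {qschur \<alpha> | \<alpha>. \<alpha> \<in> compositions}
    \<longleftrightarrow> (\<forall>q\<in>QSym. f q = q)"
proof (intro iffI conjI ballI)
  assume *: "graded_coalgebra_automorphism_QSym f \<and>
      f ` {qschur \<alpha> | \<alpha>. \<alpha> \<in> compositions} = {qschur \<alpha> | \<alpha>. \<alpha> \<in> compositions}"
  interpret qschur_preserving f
  proof
    show "coalgebra_hom_QSym f" "graded_QSym f" "inj_on f QSym"
      using * by (auto simp: graded_coalgebra_automorphism_QSym_def bij_betw_def)
    show "\<exists>\<beta>\<in>compositions. f (qschur \<alpha>) = qschur \<beta>" if "\<alpha> \<in> compositions" for \<alpha>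
      using * that by blast
  qed
  show "f q = q" if "q \<in> QSym" for q
    by (rule identity_on_QSym[OF that])
next
  assume id: "\<forall>q\<in>QSym. f q = q"
  then show "graded_coalgebra_automorphism_QSym f"
    by (rule identity_graded_coalgebra_automorphism)
  have "f ` {qschur \<alpha> | \<alpha>. \<alpha> \<in> compositions} = id ` {qschur \<alpha> | \<alpha>. \<alpha> \<in> compositions}"
    using id qschur_in_QSym by (intro image_cong) auto
  then show "f ` {qschur \<alpha> | \<alpha>. \<alpha> \<in> compositions} = {qschur \<alpha> | \<alpha>. \<alpha> \<in> compositions}"
    by simp
qed

end
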